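(* Assume that $h$ satisfies condition (A) of the context and let $\gamma\ge2\rho-1$. If $Q_{\gamma,\rho}\Delta t<1$, then the jump-adapted backward Euler method defined in the context admits a unique solution and, for $k\in\{0,1,\dots,n_T-1\}$, $\mathbb{P}\big(\{\bar Z_{t_{k+1}}>0\mid\bar Z_{t_k}>0\}\big)=1$.
   Context: Let $T\in(0,\infty)$, $M\in\mathbb{N}$, $\Delta t=T/M$. On a complete filtered probability space, $W$ is a scalar Wiener process and $N$ an independent Poisson process with intensity $\lambda>0$. The parameters $\alpha_{-1},\alpha_0,\alpha_1,\alpha_2,\alpha_3$ are positive, $\gamma,\rho>1$, $x_0>0$, and $h:\mathbb{R}\to\mathbb{R}$ is deterministic. Condition (A): $h$ is continuously differentiable and there are constants $\mu,r>0$ with $|h'(x)|\le\mu$ and $x+h(x)\ge rx$ for all $x>0$. Define $F_{\gamma,\rho}:(0,\infty)\to\mathbb{R}$ by $$F_{\gamma,\rho}(x)=(\rho-1)\Big(-\alpha_{-1}x^{\frac{\rho+1}{\rho-1}}+\alpha_0x^{\frac{\rho}{\rho-1}}-\alpha_1x+\alpha_2x^{-\frac{\gamma-\rho}{\rho-1}}+\tfrac{\rho\alpha_3^2}{2}x^{-1}\Big).$$ For $\gamma\ge2\rho-1$ the derivative $F'_{\gamma,\rho}$ is bounded above on $(0,\infty)$; fix a constant $Q_{\gamma,\rho}\in[0,\infty)$ with $\sup_{x>0}F'_{\gamma,\rho}(x)\le Q_{\gamma,\rho}$. Jump-adapted mesh: for each sample path, the deterministic points $i\Delta t$, $i=0,\dots,M$,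 are merged with the jump times of $N$ in $[0,T]$ to form the (path-dependent) partition $0=t_0<t_1<\dots<t_{n_T}=T$. Put $\Delta t_k=t_{k+1}-t_k$, $\Delta W_k=W_{t_{k+1}}-W_{t_k}$, $\Delta N_k=N_{t_{k+1}}-N_{t_k}$ (so $\Delta N_k=1$ if $t_{k+1}$ is a jump time and $\Delta N_k=0$ otherwise). Jump-adapted backward Euler method: $\bar Z_0=x_0^{1-\rho}$ and, for $k=0,\dots,n_T-1$, $$\bar Z_{t_{k+1}-}=\bar Z_{t_k}+F_{\gamma,\rho}(\bar Z_{t_{k+1}-})\Delta t_k+(1-\rho)\alpha_3\Delta W_k,$$ $$\bar Z_{t_{k+1}}=\bar Z_{t_{k+1}-}+\big[(\bar Z_{t_{k+1}-}^{\frac1{1-\rho}}+h(\bar Z_{t_{k+1}-}^{\frac1{1-\rho}}))^{1-\rho}-\bar Z_{t_{k+1}-}\big]\Delta N_k.$$ *)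

theory Defs
  imports "HOL-Probability.Probability"
begin

section \<open>The driving noise\<close>

text \<open>
  Time is indexed by the type \<^typ>\<open>real\<close>, and only times in \<open>[0, \<infinity>)\<close> matter: a filtration
  on \<open>[0, \<infinity>)\<close> is extended constantly by \<open>\<F> 0\<close> to negative times so that the
  library locale \<^locale>\<open>filtration\<close> applies.
\<close>

definition complete_filtered_prob_space :: "'a measure \<Rightarrow> (real \<Rightarrow> 'a measure) \<Rightarrow> bool" where
  "complete_filtered_prob_space P \<F> \<longleftrightarrow>
     prob_space P \<and>
     complete_measure P \<and>
     filtration (space P) \<F> \<and>
     (\<forall>t. sets (\<F> t) \<subseteq> sets P) \<and>
     null_sets P \<subseteq> sets (\<F> 0)"

definition wiener_process ::
    "'a measure \<Rightarrow> (real \<Rightarrow> 'a measure) \<Rightarrow> (real \<Rightarrow> 'a \<Rightarrow> real) \<Rightarrow> bool" where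
  "wiener_process P \<F> W \<longleftrightarrow>
     (\<forall>t\<ge>0. W t \<in> borel_measurable (\<F> t)) \<and>
     (AE \<omega> in P. W 0 \<omega> = 0) \<and>
     (\<forall>s t. 0 \<le> s \<longrightarrow> s < t \<longrightarrow>
        prob_space.indep_set P (sets (\<F> s))
          (sets (vimage_algebra (space P) (\<lambda>\<omega>. W t \<omega> - W s \<omega>) borel)) \<and>
        distributed P lborel (\<lambda>\<omega>. W t \<omega> - W s \<omega>) (normal_density 0 (sqrt (t - s)))) \<and>
     (AE \<omega> in P. continuous_on {0..} (\<lambda>t. W t \<omega>))"

text \<open>
  All paths are nondecreasing, right-continuous and \<open>\<nat>\<close>-valued.  Unit
  jump sizes are not required; they follow almost surely from the law of the increments.
\<close>

definition poisson_process ::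
    "'a measure \<Rightarrow> (real \<Rightarrow> 'a measure) \<Rightarrow> real \<Rightarrow> (real \<Rightarrow> 'a \<Rightarrow> nat) \<Rightarrow> bool" where
  "poisson_process P \<F> rate N \<longleftrightarrow>
     (\<forall>t\<ge>0. N t \<in> measurable (\<F> t) (count_space UNIV)) \<and>
     (\<forall>\<omega>\<in>space P. N 0 \<omega> = 0 \<and> mono_on {0..} (\<lambda>t. N t \<omega>) \<and>
        (\<forall>t\<ge>0. continuous (at_right t) (\<lambda>s. real (N s \<omega>)))) \<and>
     (\<forall>s t. 0 \<le> s \<longrightarrow> s < t \<longrightarrow>
        prob_space.indep_set P (sets (\<F> s))
          (sets (vimage_algebra (space P) (\<lambda>\<omega>. N t \<omega> - N s \<omega>) (count_space UNIV))) \<and>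
        distr P (count_space UNIV) (\<lambda>\<omega>. N t \<omega> - N s \<omega>) =
          measure_pmf (poisson_pmf (rate * (t - s))))"

definition independent_processes ::
    "'a measure \<Rightarrow> (real \<Rightarrow> 'a \<Rightarrow> real) \<Rightarrow> (real \<Rightarrow> 'a \<Rightarrow> nat) \<Rightarrow> bool" where
  "independent_processes P W N \<longleftrightarrow>
     prob_space.indep_var P
       (PiM {0..} (\<lambda>_. borel)) (\<lambda>\<omega>. \<lambda>t\<in>{0..}. W t \<omega>)
       (PiM {0..} (\<lambda>_. borel)) (\<lambda>\<omega>. \<lambda>t\<in>{0..}. real (N t \<omega>))"


section \<open>Coefficients\<close>

text \<open>The bounds are only required on the positive half-line.\<close>

definition condition_A :: "(real \<Rightarrow> real) \<Rightarrow> bool" where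
  "condition_A h \<longleftrightarrow>
     h C1_differentiable_on UNIV \<and>
     (\<exists>\<mu>>0. \<exists>r>0. \<forall>x>0. \<bar>deriv h x\<bar> \<le> \<mu> \<and> x + h x \<ge> r * x)"

text \<open>
  \<open>am1, a0, a1, a2, a3\<close> stand for \<open>\<alpha>\<^sub>-\<^sub>1, \<alpha>\<^sub>0, \<alpha>\<^sub>1, \<alpha>\<^sub>2, \<alpha>\<^sub>3\<close>; only values at \<open>x > 0\<close> are
  meaningful.
\<close>

definition drift ::
    "real \<Rightarrow> real \<Rightarrow> real \<Rightarrow> real \<Rightarrow> real \<Rightarrow> real \<Rightarrow> real \<Rightarrow> real \<Rightarrow> real" where
  "drift am1 a0 a1 a2 a3 \<gamma> \<rho> x =
     (\<rho> - 1) *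
       (- am1 * x powr ((\<rho> + 1) / (\<rho> - 1))
        + a0 * x powr (\<rho> / (\<rho> - 1))
        - a1 * x
        + a2 * x powr (- ((\<gamma> - \<rho>) / (\<rho> - 1)))
        + (\<rho> * a3\<^sup>2 / 2) * inverse x)"


section \<open>Jump-adapted mesh\<close>

definition jump_times :: "(real \<Rightarrow> 'a \<Rightarrow> nat) \<Rightarrow> real \<Rightarrow> 'a \<Rightarrow> real set" where
  "jump_times N T \<omega> = {t \<in> {0<..T}. \<not> continuous (at_left t) (\<lambda>s. real (N s \<omega>))}"

definition mesh_set :: "(real \<Rightarrow> 'a \<Rightarrow> nat) \<Rightarrow> real \<Rightarrow> nat \<Rightarrow> 'a \<Rightarrow> real set" where
  "mesh_set N T M \<omega> = (\<lambda>i. real i * (T / real M)) ` {0..M} \<union> jump_times N T \<omega>"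

definition mesh_point :: "(real \<Rightarrow> 'a \<Rightarrow> nat) \<Rightarrow> real \<Rightarrow> nat \<Rightarrow> nat \<Rightarrow> 'a \<Rightarrow> real" where
  "mesh_point N T M k \<omega> = sorted_list_of_set (mesh_set N T M \<omega>) ! k"

definition mesh_last :: "(real \<Rightarrow> 'a \<Rightarrow> nat) \<Rightarrow> real \<Rightarrow> nat \<Rightarrow> 'a \<Rightarrow> nat" where
  "mesh_last N T M \<omega> = card (mesh_set N T M \<omega>) - 1"


section \<open>Jump-adapted backward Euler method\<close>

text \<open>
  \<open>Z k \<omega>\<close> is the approximation at the mesh point \<open>t\<^sub>k\<close>, and \<open>Zm k \<omega>\<close> (for \<open>k \<ge> 1\<close>) the one at
  \<open>t\<^sub>k-\<close>; the values at indices \<open>k > n\<^sub>T\<close> are unconstrained.  The drift \<open>f\<close> and the power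
  \<open>z \<mapsto> z\<^bsup>1/(1-\<rho>)\<^esup>\<close> are defined on \<open>(0, \<infinity>)\<close> only, so the equations are meaningful only for
  \<open>Zm (k + 1) \<omega> > 0\<close>, which is stated explicitly since \<^const>\<open>powr\<close> is total.  Positivity
  of \<open>Z\<close> itself is not part of the definition.
\<close>

definition backward_euler_solution ::
    "'a measure \<Rightarrow> (real \<Rightarrow> 'a \<Rightarrow> real) \<Rightarrow> (real \<Rightarrow> 'a \<Rightarrow> nat) \<Rightarrow> real \<Rightarrow> nat \<Rightarrow>
     (real \<Rightarrow> real) \<Rightarrow> (real \<Rightarrow> real) \<Rightarrow> real \<Rightarrow> real \<Rightarrow> real \<Rightarrow>
     (nat \<Rightarrow> 'a \<Rightarrow> real) \<Rightarrow> (nat \<Rightarrow> 'a \<Rightarrow> real) \<Rightarrow> bool" where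
  "backward_euler_solution P W N T M f h a3 \<rho> x0 Zm Z \<longleftrightarrow>
     (\<forall>\<omega>\<in>space P.
        Z 0 \<omega> = x0 powr (1 - \<rho>) \<and>
        (\<forall>k<mesh_last N T M \<omega>.
           let t = mesh_point N T M k \<omega>;
               t' = mesh_point N T M (k + 1) \<omega>;
               dW = W t' \<omega> - W t \<omega>;
               dN = real (N t' \<omega>) - real (N t \<omega>);
               z = Zm (k + 1) \<omega>;
               y = z powr (1 / (1 - \<rho>))
           in z > 0 \<and>
              z = Z k \<omega> + f z * (t' - t) + (1 - \<rho>) * a3 * dW \<and>
              Z (k + 1) \<omega> = z + ((y + h y) powr (1 - \<rho>) - z) * dN))"

end

theory Submission
  imports Defs
begin

text \<open>
  The equations are solved path by path.  Probability enters through the sizes of the jumps, the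
  conditioning and the measurability of the scheme.

  For a step \<open>\<delta>\<close> of the mesh, the left value \<open>z\<close> solves \<open>z = c + f z * \<delta>\<close> with known \<open>c\<close>. Every step
  is at most \<open>T / M\<close>, because the deterministic grid belongs to the mesh. Hence \<open>Q * \<delta> < 1\<close>, the map
  \<open>z \<mapsto> z - f z * \<delta>\<close> has a positive derivative, and solutions are unique. The drift explodes to \<open>\<infinity>\<close>
  at the origin and is bounded above near \<open>\<infinity>\<close>, so on \<open>(0, \<infinity>)\<close> this map takes every real value
  (\<open>implicit_equation_ex1\<close>). The equation thus has a positive solution whatever the sign of \<open>c\<close>, and
  the recursion never breaks down, even on exceptional paths on which \<open>Z\<close> becomes negative.

  After the left value \<open>z > 0\<close> has been found, the next value is \<open>z\<close> itself if \<open>N\<close> does not jump, and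
  \<open>(y + h y)\<^bsup>1-\<rho>\<^esup>\<close> with \<open>y = z\<^bsup>1/(1-\<rho>)\<^esup> > 0\<close> if \<open>N\<close> jumps by one. Both are positive, since \<open>y + h y \<ge> r y > 0\<close>
  (\<open>scheme_pos\<close>). A larger jump could destroy positivity, but almost surely there is none
  (\<open>AE_unit_jumps\<close>). The conditional probability also requires that its condition has positive
  probability. This holds because a Poisson process makes arbitrarily many jumps in \<open>[0, T]\<close> with
  positive probability (\<open>prob_less_mesh_last_pos\<close>).

  Measurability of the scheme rests on three observations. Counting mesh points up to a time
  amounts to countably many conditions on the values of \<open>N\<close> at fixed times, so mesh points are random
  variables (\<open>mesh_count_measurable\<close>). A process with almost surely right-continuous paths can be
  evaluated at a random time (\<open>borel_measurable_at_random_time\<close>). The solution of the implicit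
  equation is at most \<open>a > 0\<close> iff \<open>c \<le> a - f a * \<delta>\<close> (\<open>borel_measurable_implicit_euler_step\<close>).
\<close>

section \<open>Counting paths and their jumps\<close>

definition counting_path :: "(real \<Rightarrow> nat) \<Rightarrow> bool" where
  "counting_path n \<longleftrightarrow>
     mono_on {0..} n \<and> (\<forall>t\<ge>0. continuous (at_right t) (\<lambda>s. real (n s)))"

lemma counting_path_mono: "counting_path n \<Longrightarrow> 0 \<le> s \<Longrightarrow> s \<le> t \<Longrightarrow> n s \<le> n t"
  by (auto simp: counting_path_def mono_on_def)

text \<open>
  For a monotone path with values in \<open>\<nat>\<close>, left-continuity at \<open>t\<close> means constancy on some
  interval that ends at \<open>t\<close>.
\<close>

lemma jump_time_iff:
  assumes "counting_path (\<lambda>t. N t \<omega>)"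
  shows "t \<in> jump_times N T \<omega> \<longleftrightarrow> 0 < t \<and> t \<le> T \<and> (\<forall>s. 0 \<le> s \<and> s < t \<longrightarrow> N s \<omega> < N t \<omega>)"
proof (cases "0 < t \<and> t \<le> T")
  case True
  have "continuous (at_left t) (\<lambda>s. real (N s \<omega>)) \<longleftrightarrow> (\<exists>s. 0 \<le> s \<and> s < t \<and> N s \<omega> = N t \<omega>)"
  proof
    assume "continuous (at_left t) (\<lambda>s. real (N s \<omega>))"
    then have "((\<lambda>s. real (N s \<omega>)) \<longlongrightarrow> real (N t \<omega>)) (at_left t)"
      by (simp add: continuous_within)
    then have "\<forall>\<^sub>F s in at_left t. dist (real (N s \<omega>)) (real (N t \<omega>)) < 1"
      by (rule tendstoD) simp
    moreover have "\<forall>\<^sub>F s in at_left t. s \<in> {0<..<t}"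
      using True eventually_at_left_real by blast
    ultimately have "\<forall>\<^sub>F s in at_left t. 0 \<le> s \<and> s < t \<and> N s \<omega> = N t \<omega>"
      by eventually_elim (auto simp: dist_real_def)
    then show "\<exists>s. 0 \<le> s \<and> s < t \<and> N s \<omega> = N t \<omega>"
      using eventually_happens' trivial_limit_at_left_real by blast
  next
    assume "\<exists>s. 0 \<le> s \<and> s < t \<and> N s \<omega> = N t \<omega>"
    then obtain s where s: "0 \<le> s" "s < t" "N s \<omega> = N t \<omega>" by blast
    have "\<forall>\<^sub>F u in at_left t. u \<in> {s<..<t}"
      using s eventually_at_left_real by blast
    then have "\<forall>\<^sub>F u in at_left t. real (N t \<omega>) = real (N u \<omega>)"
    proof eventually_elim
      case (elim u)
      then show ?case
        using s counting_path_mono[OF assms, of s u] counting_path_mono[OF assms, of u t] by auto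
    qed
    then show "continuous (at_left t) (\<lambda>s. real (N s \<omega>))"
      unfolding continuous_within by (rule Lim_transform_eventually[rotated]) simp
  qed
  then show ?thesis
    using True counting_path_mono[OF assms] unfolding jump_times_def
    by (auto simp: less_le)
qed (auto simp: jump_times_def)

text \<open>
  An increasing cell contains the first time at which the path attains its value at the right end.
  Right-continuity makes this infimum an attained minimum, and a jump sits there.
\<close>

lemma jump_in_cell_iff:
  assumes path: "counting_path (\<lambda>t. N t \<omega>)" and "0 \<le> s" "s \<le> t" "t \<le> T"
  shows "jump_times N T \<omega> \<inter> {s<..t} \<noteq> {} \<longleftrightarrow> N s \<omega> < N t \<omega>"
proof
  assume "jump_times N T \<omega> \<inter> {s<..t} \<noteq> {}"
  then obtain u where "u \<in> jump_times N T \<omega>" "s < u" "u \<le> t" by auto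
  then show "N s \<omega> < N t \<omega>"
    using jump_time_iff[of N \<omega> u T] assms counting_path_mono[OF path, of u t]
    by (metis less_eq_real_def order.strict_trans2)
next
  assume less: "N s \<omega> < N t \<omega>"
  define A where "A = {v \<in> {s..t}. N v \<omega> = N t \<omega>}"
  define u where "u = Inf A"
  have A: "t \<in> A" "bdd_below A"
    using assms by (auto simp: A_def bdd_below_def)
  have u: "s \<le> u" "u \<le> t"
    unfolding u_def using A by (auto intro!: cInf_greatest cInf_lower simp: A_def)
  have "((\<lambda>v. real (N v \<omega>)) \<longlongrightarrow> real (N u \<omega>)) (at_right u)"
    using path u assms unfolding counting_path_def continuous_within by auto
  then have "\<forall>\<^sub>F v in at_right u. dist (real (N v \<omega>)) (real (N u \<omega>)) < 1"
    by (rule tendstoD) simp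
  then have "\<forall>\<^sub>F v in at_right u. N v \<omega> = N u \<omega>"
    by eventually_elim (simp add: dist_real_def)
  then obtain b where b: "u < b" "\<And>v. u < v \<Longrightarrow> v < b \<Longrightarrow> N v \<omega> = N u \<omega>"
    unfolding eventually_at_right_field by blast
  have Nu: "N u \<omega> = N t \<omega>"
  proof -
    obtain v where v: "v \<in> A" "v < b"
      using b(1) A cInf_less_iff[of A b] unfolding u_def by blast
    then have "u \<le> v"
      unfolding u_def using A by (intro cInf_lower)
    then show ?thesis
      using b(2)[of v] v by (cases "u = v") (auto simp: A_def)
  qed
  have "u \<in> jump_times N T \<omega>"
    unfolding jump_time_iff[of N, OF path]
  proof (intro conjI allI impI)
    show "0 < u"
      using less Nu u assms(2) by (cases "u = s") auto
    show "u \<le> T" using u assms by simp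
    fix v assume v: "0 \<le> v \<and> v < u"
    show "N v \<omega> < N u \<omega>"
    proof (rule ccontr)
      assume "\<not> N v \<omega> < N u \<omega>"
      then have "N v \<omega> = N t \<omega>"
        using counting_path_mono[OF path, of v u] v Nu by auto
      moreover have "s \<le> v"
        using calculation less counting_path_mono[OF path, of v s] v by fastforce
      ultimately have "v \<in> A"
        using v u by (auto simp: A_def)
      then show False
        using v A cInf_lower[of v A] unfolding u_def by auto
    qed
  qed
  moreover have "s < u"
    using less Nu u by (cases "u = s") auto
  ultimately show "jump_times N T \<omega> \<inter> {s<..t} \<noteq> {}"
    using u by auto
qed

text \<open>Each jump uses up a value of the path, and there are at most \<open>N T \<omega> + 1\<close> values.\<close>

lemma finite_jump_times:
  assumes path: "counting_path (\<lambda>t. N t \<omega>)"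
  shows "finite (jump_times N T \<omega>)"
proof (rule inj_on_finite[of "\<lambda>t. N t \<omega>" _ "{..N T \<omega>}"])
  show "inj_on (\<lambda>t. N t \<omega>) (jump_times N T \<omega>)"
  proof (rule linorder_inj_onI')
    fix s t assume "s \<in> jump_times N T \<omega>" "t \<in> jump_times N T \<omega>" "s < t"
    then have "N s \<omega> < N t \<omega>"
      by (auto simp: jump_time_iff[of N, OF path])
    then show "N s \<omega> \<noteq> N t \<omega>" by simp
  qed
  show "(\<lambda>t. N t \<omega>) ` jump_times N T \<omega> \<subseteq> {..N T \<omega>}"
    using counting_path_mono[OF path, of _ T] by (auto simp: jump_time_iff[of N, OF path])
qed simp

section \<open>Counting the points of a finite set\<close>

lemma nth_sorted_list_le_iff:
  fixes S :: "'b::linorder set"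
  assumes "finite S" "k < card S"
  shows "sorted_list_of_set S ! k \<le> t \<longleftrightarrow> k < card (S \<inter> {..t})"
proof -
  let ?xs = "sorted_list_of_set S"
  let ?I = "{i. i < card S \<and> ?xs ! i \<le> t}"
  have inj: "inj_on (\<lambda>i. ?xs ! i) ?I"
    by (rule inj_on_subset[OF inj_on_nth[of ?xs "{..<card S}"]]) auto
  have "(\<lambda>i. ?xs ! i) ` ?I = S \<inter> {..t}"
    using set_sorted_list_of_set[OF assms(1)] by (auto simp: set_conv_nth)
  then have card: "card (S \<inter> {..t}) = card ?I"
    using card_image[OF inj] by simp
  have mono: "?xs ! i \<le> ?xs ! j" if "i \<le> j" "j < card S" for i j
    using that by (intro sorted_nth_mono) auto
  have fin: "finite ?I" by simp
  show ?thesis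
  proof
    assume "?xs ! k \<le> t"
    then have "{..k} \<subseteq> ?I"
      using mono assms(2) by (auto intro: order.trans)
    from card_mono[OF fin this] show "k < card (S \<inter> {..t})"
      by (simp add: card)
  next
    assume *: "k < card (S \<inter> {..t})"
    show "?xs ! k \<le> t"
    proof (rule ccontr)
      assume "\<not> ?xs ! k \<le> t"
      then have "?I \<subseteq> {..<k}"
        using mono by (metis (no_types, lifting) lessThan_iff mem_Collect_eq not_le order.trans subsetI)
      from card_mono[OF _ this] show False
        using * by (simp add: card)
    qed
  qed
qed

lemma sorted_list_of_set_consecutive:
  fixes S :: "'b::linorder set"
  assumes "finite S" "Suc k < card S"
  shows "sorted_list_of_set S ! k < sorted_list_of_set S ! Suc k"
    and "S \<inter> {sorted_list_of_set S ! k <..< sorted_list_of_set S ! Suc k} = {}"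
proof -
  let ?xs = "sorted_list_of_set S"
  have mono: "?xs ! i < ?xs ! j" if "i < j" "j < card S" for i j
    using that by (intro sorted_wrt_nth_less[of "(<)"]) auto
  show "?xs ! k < ?xs ! Suc k"
    using mono assms by simp
  have False if "s \<in> S" "?xs ! k < s" "s < ?xs ! Suc k" for s
  proof -
    have "s \<in> set ?xs" using that assms by simp
    then obtain i where i: "i < card S" "s = ?xs ! i" by (auto simp: set_conv_nth)
    show False
    proof (cases "i \<le> k")
      case True
      then show False using mono[of i k] that i assms by (cases "i = k") auto
    next
      case False
      then show False using mono[of "Suc k" i] that i assms by (cases "i = Suc k") auto
    qed
  qed
  then show "S \<inter> {?xs ! k <..< ?xs ! Suc k} = {}" by auto
qed

definition uniform_cell :: "real \<Rightarrow> nat \<Rightarrow> nat \<Rightarrow> real set" where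
  "uniform_cell t n i = {t * i / n <.. t * Suc i / n}"

lemma uniform_cell_exists:
  assumes "0 < s" "s \<le> t" "n > 0"
  shows "\<exists>i<n. s \<in> uniform_cell t n i"
proof -
  define c where "c = \<lceil>s * n / t\<rceil>"
  have t: "0 < t" using assms by simp
  have pos: "0 < s * n / t" using assms t by simp
  have c: "1 \<le> c" "c \<le> n"
    unfolding c_def using assms t pos
    by (auto simp: ceiling_le_iff field_simps)
  define i where "i = nat (c - 1)"
  have i: "real i = of_int c - 1" "i < n"
    using c by (auto simp: i_def)
  have "real i < s * n / t" "s * n / t \<le> real i + 1"
    unfolding i(1) c_def by linarith+
  then have "s \<in> uniform_cell t n i"
    using assms t by (auto simp: uniform_cell_def field_simps)
  then show ?thesis using i by blast
qed

lemma uniform_cell_disjoint: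
  assumes "s \<in> uniform_cell t n i" "s \<in> uniform_cell t n j" "0 < t" "n > 0"
  shows "i = j"
proof -
  have "t * i < s * n" "s * n \<le> t * Suc i" "t * j < s * n" "s * n \<le> t * Suc j"
    using assms by (auto simp: uniform_cell_def field_simps)
  then have "t * i < t * Suc j" "t * j < t * Suc i"
    by linarith+
  then have "real i < Suc j" "real j < Suc i"
    using assms(3) mult_less_cancel_left_pos by blast+
  then show "i = j" by linarith
qed

text \<open>
  Counting points through the cells of uniform partitions turns a statement about unknown
  locations into countably many statements about the occupation of fixed intervals.  A partition
  finer than the least distance between two points separates all of them.
\<close>

lemma card_ge_iff_occupied_cells:
  fixes S :: "real set"
  assumes fin: "finite S" and t: "0 < t"
  shows "k \<le> card (S \<inter> {0<..t}) \<longleftrightarrow>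
     (\<exists>n>0. \<exists>I\<in>{I \<in> Pow {..<n}. card I = k}. \<forall>i\<in>I. S \<inter> uniform_cell t n i \<noteq> {})"
proof
  assume k: "k \<le> card (S \<inter> {0<..t})"
  obtain d where d: "d > 0" "\<And>x y. x \<in> S \<Longrightarrow> y \<in> S \<Longrightarrow> x \<noteq> y \<Longrightarrow> d \<le> dist x y"
  proof -
    have "uniform_discrete S"
      using fin by induction (simp_all add: uniform_discrete_insert)
    then show ?thesis
      using that unfolding uniform_discrete_def by (meson not_le)
  qed
  obtain n :: nat where n: "t / d < n" using reals_Archimedean2 by blast
  have n0: "n > 0"
    using n t d(1) by (metis divide_pos_pos not_gr_zero of_nat_0 order.asym)
  obtain B where B: "B \<subseteq> S \<inter> {0<..t}" "card B = k"
    using k obtain_subset_with_card_n by metis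
  have "\<forall>s\<in>B. \<exists>i. i < n \<and> s \<in> uniform_cell t n i"
  proof
    fix s assume "s \<in> B"
    then have "0 < s" "s \<le> t" using B by auto
    then show "\<exists>i. i < n \<and> s \<in> uniform_cell t n i"
      by (rule uniform_cell_exists[OF _ _ n0])
  qed
  from bchoice[OF this] obtain c
    where c: "\<And>s. s \<in> B \<Longrightarrow> c s < n \<and> s \<in> uniform_cell t n (c s)"
    by blast
  have inj: "inj_on c B"
  proof (rule inj_onI, rule ccontr)
    fix x y assume xy: "x \<in> B" "y \<in> B" "c x = c y" "x \<noteq> y"
    have "x \<in> uniform_cell t n (c x)" "y \<in> uniform_cell t n (c x)"
      using c[OF xy(1)] c[OF xy(2)] xy(3) by simp_all
    then have "dist x y < t / n"
      by (auto simp: uniform_cell_def dist_real_def abs_real_def distrib_left add_divide_distrib)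
    also have "\<dots> < d"
      using n n0 d(1) t by (simp add: field_simps)
    finally show False
      using d(2)[of x y] xy B by auto
  qed
  have "c ` B \<in> {I \<in> Pow {..<n}. card I = k}"
    using c B card_image[OF inj] by auto
  moreover have "\<forall>i\<in>c ` B. S \<inter> uniform_cell t n i \<noteq> {}"
    using c B by blast
  ultimately show "\<exists>n>0. \<exists>I\<in>{I \<in> Pow {..<n}. card I = k}. \<forall>i\<in>I. S \<inter> uniform_cell t n i \<noteq> {}"
    using n0 by blast
next
  assume "\<exists>n>0. \<exists>I\<in>{I \<in> Pow {..<n}. card I = k}. \<forall>i\<in>I. S \<inter> uniform_cell t n i \<noteq> {}"
  then obtain n I where n: "n > 0" and I: "I \<subseteq> {..<n}" "card I = k"
    "\<forall>i\<in>I. \<exists>s. s \<in> S \<inter> uniform_cell t n i" by blast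
  from bchoice[OF I(3)] obtain p where p: "\<And>i. i \<in> I \<Longrightarrow> p i \<in> S \<inter> uniform_cell t n i"
    by blast
  have "inj_on p I"
    using p uniform_cell_disjoint[OF _ _ t n] by (metis IntD2 inj_onI)
  moreover have "p ` I \<subseteq> S \<inter> {0<..t}"
  proof
    fix s assume "s \<in> p ` I"
    then obtain i where i: "i \<in> I" "s = p i" by blast
    then have "i < n" using I by auto
    have "0 \<le> t * real i / n" using t n by simp
    moreover have "t * real (Suc i) / n \<le> t"
      using t n \<open>i < n\<close> by (simp add: divide_le_eq)
    ultimately show "s \<in> S \<inter> {0<..t}"
      using p[OF i(1)] i(2) by (auto simp: uniform_cell_def)
  qed
  ultimately show "k \<le> card (S \<inter> {0<..t})"
    using fin I(2) card_inj_on_le by blast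
qed

section \<open>The jump-adapted mesh\<close>

context
  fixes N :: "real \<Rightarrow> 'a \<Rightarrow> nat" and \<omega> :: 'a and T :: real and M :: nat
  assumes path: "counting_path (\<lambda>t. N t \<omega>)" and T: "T > 0" and M: "M > 0"
begin

lemma finite_mesh_set: "finite (mesh_set N T M \<omega>)"
  unfolding mesh_set_def using finite_jump_times[of N, OF path] by simp

lemma mesh_set_subset: "mesh_set N T M \<omega> \<subseteq> {0..T}"
  unfolding mesh_set_def jump_times_def using T M by (auto simp: field_simps)

lemma zero_in_mesh_set: "0 \<in> mesh_set N T M \<omega>"
  unfolding mesh_set_def by (auto intro!: image_eqI[of _ _ 0])

lemma mesh_last_less_card: "k \<le> mesh_last N T M \<omega> \<longleftrightarrow> k < card (mesh_set N T M \<omega>)"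
proof -
  have "card (mesh_set N T M \<omega>) > 0"
    using finite_mesh_set zero_in_mesh_set by (auto simp: card_gt_0_iff)
  then show ?thesis unfolding mesh_last_def by linarith
qed

text \<open>
  The origin is counted separately, since the cells that are used for counting are open on the left.
\<close>

lemma card_mesh_set_atMost:
  assumes "0 \<le> t"
  shows "card (mesh_set N T M \<omega> \<inter> {..t}) = Suc (card (mesh_set N T M \<omega> \<inter> {0<..t}))"
proof -
  have "mesh_set N T M \<omega> \<inter> {..t} = insert 0 (mesh_set N T M \<omega> \<inter> {0<..t})"
    using zero_in_mesh_set mesh_set_subset assms by force
  then show ?thesis using finite_mesh_set by simp
qed

lemma le_mesh_last_iff:
  "k \<le> mesh_last N T M \<omega> \<longleftrightarrow> k \<le> card (mesh_set N T M \<omega> \<inter> {0<..T})"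
proof -
  have "mesh_set N T M \<omega> \<inter> {..T} = mesh_set N T M \<omega>"
    using mesh_set_subset by auto
  then show ?thesis
    using card_mesh_set_atMost[of T] T by (simp add: mesh_last_less_card less_Suc_eq_le)
qed

lemma mesh_point_le_iff:
  assumes "k \<le> mesh_last N T M \<omega>" "0 \<le> t"
  shows "mesh_point N T M k \<omega> \<le> t \<longleftrightarrow> k \<le> card (mesh_set N T M \<omega> \<inter> {0<..t})"
  using assms card_mesh_set_atMost[of t] nth_sorted_list_le_iff[OF finite_mesh_set, of k t]
  by (simp add: mesh_point_def mesh_last_less_card less_Suc_eq_le)

lemma mesh_point_in:
  assumes "k \<le> mesh_last N T M \<omega>"
  shows "mesh_point N T M k \<omega> \<in> mesh_set N T M \<omega>"
  using assms nth_mem[of k "sorted_list_of_set (mesh_set N T M \<omega>)"] finite_mesh_set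
  by (simp add: mesh_point_def mesh_last_less_card)

lemma mesh_point_bounds:
  assumes "k \<le> mesh_last N T M \<omega>"
  shows "0 \<le> mesh_point N T M k \<omega>" "mesh_point N T M k \<omega> \<le> T"
  using mesh_point_in[OF assms] mesh_set_subset by auto

lemma mesh_point_less:
  assumes "k < mesh_last N T M \<omega>"
  shows "mesh_point N T M k \<omega> < mesh_point N T M (k + 1) \<omega>"
  using assms sorted_list_of_set_consecutive(1)[OF finite_mesh_set, of k]
    mesh_last_less_card[of "Suc k"]
  by (simp add: mesh_point_def)

lemma no_mesh_point_between:
  assumes "k < mesh_last N T M \<omega>"
  shows "mesh_set N T M \<omega> \<inter> {mesh_point N T M k \<omega> <..< mesh_point N T M (k + 1) \<omega>} = {}"
  using assms sorted_list_of_set_consecutive(2)[OF finite_mesh_set, of k]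
    mesh_last_less_card[of "Suc k"]
  by (simp add: mesh_point_def)

lemma mesh_step_le:
  assumes "k < mesh_last N T M \<omega>"
  shows "mesh_point N T M (k + 1) \<omega> - mesh_point N T M k \<omega> \<le> T / M"
proof -
  let ?t = "mesh_point N T M k \<omega>" and ?t' = "mesh_point N T M (k + 1) \<omega>"
  have t: "0 \<le> ?t" "?t < ?t'" "?t' \<le> T"
    using mesh_point_bounds[of k] mesh_point_bounds[of "k + 1"] mesh_point_less[OF assms] assms
    by auto
  obtain i where i: "i < M" "?t' \<in> uniform_cell T M i"
    using uniform_cell_exists[of ?t' T M] t M by auto
  \<comment> \<open>The left end of the cell of \<open>?t'\<close> is itself a mesh point before \<open>?t'\<close>.\<close>
  have "real i * (T / M) \<in> mesh_set N T M \<omega>"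
    using i by (auto simp: mesh_set_def)
  moreover have "real i * (T / M) < ?t'" "?t' \<le> real i * (T / M) + T / M"
    using i by (auto simp: uniform_cell_def field_simps)
  ultimately show ?thesis
    using no_mesh_point_between[OF assms] by fastforce
qed

text \<open>All jump times belong to the mesh, so none lies strictly between consecutive mesh points.\<close>

lemma counting_path_before_mesh_point:
  assumes "k < mesh_last N T M \<omega>" "mesh_point N T M k \<omega> \<le> s" "s < mesh_point N T M (k + 1) \<omega>"
  shows "N s \<omega> = N (mesh_point N T M k \<omega>) \<omega>"
proof -
  let ?t = "mesh_point N T M k \<omega>"
  have t: "0 \<le> ?t" "s \<le> T"
    using mesh_point_bounds[of k] mesh_point_bounds[of "k + 1"] assms by auto
  have "jump_times N T \<omega> \<inter> {?t<..s} = {}"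
    using no_mesh_point_between[OF assms(1)] assms(3) by (force simp: mesh_set_def)
  then have "\<not> N ?t \<omega> < N s \<omega>"
    using jump_in_cell_iff[of N, OF path t(1) assms(2) t(2)] by simp
  then show ?thesis
    using counting_path_mono[OF path t(1) assms(2)] by auto
qed

end

section \<open>The implicit Euler equation\<close>

text \<open>
  A one-sided Lipschitz bound \<open>Q\<close> on \<open>f\<close> with \<open>Q * \<delta> < 1\<close> makes \<open>z \<mapsto> z - f z * \<delta>\<close> increasing,
  which yields uniqueness in the implicit equation and also measurability of its solution.
\<close>

lemma implicit_map_strict_mono:
  fixes f :: "real \<Rightarrow> real"
  assumes diff: "\<And>x. 0 < x \<Longrightarrow> f differentiable at x"
    and Q: "\<And>x. 0 < x \<Longrightarrow> deriv f x \<le> Q"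
    and "0 < \<delta>" "Q * \<delta> < 1" "0 < x" "x < y"
  shows "x - f x * \<delta> < y - f y * \<delta>"
proof (rule DERIV_pos_imp_increasing[OF \<open>x < y\<close>])
  fix z assume "x \<le> z" "z \<le> y"
  then have z: "0 < z" using assms by simp
  have "(f has_real_derivative deriv f z) (at z)"
    using diff[OF z] by (simp add: DERIV_deriv_iff_real_differentiable)
  then have der: "((\<lambda>z. z - f z * \<delta>) has_real_derivative 1 - deriv f z * \<delta>) (at z)"
    by (auto intro!: derivative_eq_intros)
  have "deriv f z * \<delta> \<le> Q * \<delta>"
    using Q[OF z] assms by (intro mult_right_mono) auto
  then have "0 < 1 - deriv f z * \<delta>"
    using \<open>Q * \<delta> < 1\<close> by linarith
  with der show "\<exists>d. ((\<lambda>z. z - f z * \<delta>) has_real_derivative d) (at z) \<and> 0 < d"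
    by blast
qed

text \<open>
  The explosion of \<open>f\<close> at the origin pushes \<open>z - f z * \<delta>\<close> down to \<open>-\<infinity>\<close>, and the bound at infinity
  lets it grow to \<open>\<infinity>\<close>. Hence every real \<open>c\<close> is attained, also a negative one.
\<close>

lemma implicit_equation_ex1:
  fixes f :: "real \<Rightarrow> real"
  assumes diff: "\<And>x. 0 < x \<Longrightarrow> f differentiable at x"
    and Q: "\<And>x. 0 < x \<Longrightarrow> deriv f x \<le> Q"
    and zero: "filterlim f at_top (at_right 0)"
    and infinity: "\<forall>\<^sub>F x in at_top. f x \<le> B"
    and \<delta>: "0 < \<delta>" "Q * \<delta> < 1"
  shows "\<exists>!z. 0 < z \<and> z = c + f z * \<delta>"
proof -
  let ?g = "\<lambda>z. z - f z * \<delta>"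
  have "\<forall>\<^sub>F x in at_right 0. (1 - c) / \<delta> \<le> f x \<and> x \<in> {0<..<1}"
    using zero eventually_at_right_real[of 0 1] by (auto simp: filterlim_at_top eventually_conj_iff)
  then obtain a where a: "(1 - c) / \<delta> \<le> f a" "0 < a" "a < 1"
    by (metis (mono_tags, lifting) eventually_happens' greaterThanLessThan_iff
        trivial_limit_at_right_real)
  have "\<forall>\<^sub>F x in at_top. f x \<le> B \<and> max 1 (c + B * \<delta>) \<le> x"
    using infinity eventually_ge_at_top by (rule eventually_conj)
  then obtain b where b: "f b \<le> B" "1 \<le> b" "c + B * \<delta> \<le> b"
    by (auto simp: eventually_at_top_linorder)
  have "?g a \<le> c"
    using a \<delta> by (simp add: field_simps)
  moreover have "c \<le> ?g b"
    using b \<delta> mult_right_mono[of "f b" B \<delta>] by linarith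
  moreover have "continuous_on {a..b} ?g"
    using diff a
    by (intro continuous_intros)
      (auto intro!: continuous_at_imp_continuous_on differentiable_imp_continuous_within)
  ultimately obtain z where "a \<le> z" "?g z = c"
    using IVT'[of ?g a c b] a b by auto
  then have z: "0 < z \<and> z = c + f z * \<delta>"
    using a by simp
  moreover have "z' = z" if "0 < z' \<and> z' = c + f z' * \<delta>" for z'
    using implicit_map_strict_mono[OF diff Q \<delta>, of z' z]
      implicit_map_strict_mono[OF diff Q \<delta>, of z z'] that z
    by (cases z z' rule: linorder_cases) auto
  ultimately show ?thesis by blast
qed

definition implicit_euler_step :: "(real \<Rightarrow> real) \<Rightarrow> real \<Rightarrow> real \<Rightarrow> real" where
  "implicit_euler_step f \<delta> c = (THE z. 0 < z \<and> z = c + f z * \<delta>)"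

text \<open>
  By monotonicity, the solution is at most \<open>a > 0\<close> iff \<open>c \<le> a - f a * \<delta>\<close>, a condition on the data in
  which the solution no longer occurs.
\<close>

lemma borel_measurable_implicit_euler_step:
  fixes f :: "real \<Rightarrow> real"
  assumes diff: "\<And>x. 0 < x \<Longrightarrow> f differentiable at x"
    and Q: "\<And>x. 0 < x \<Longrightarrow> deriv f x \<le> Q"
    and zero: "filterlim f at_top (at_right 0)"
    and infinity: "\<forall>\<^sub>F x in at_top. f x \<le> B"
    and meas: "\<delta> \<in> borel_measurable M" "c \<in> borel_measurable M" "E \<in> sets M"
    and E: "\<And>\<omega>. \<omega> \<in> E \<Longrightarrow> 0 < \<delta> \<omega> \<and> Q * \<delta> \<omega> < 1"
  shows "(\<lambda>\<omega>. if \<omega> \<in> E then implicit_euler_step f (\<delta> \<omega>) (c \<omega>) else 0) \<in> borel_measurable M"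
proof (rule borel_measurableI_le)
  fix a :: real
  let ?z = "\<lambda>\<omega>. implicit_euler_step f (\<delta> \<omega>) (c \<omega>)"
  note [measurable] = meas
  have z: "0 < ?z \<omega> \<and> ?z \<omega> = c \<omega> + f (?z \<omega>) * \<delta> \<omega>" if "\<omega> \<in> E" for \<omega>
    unfolding implicit_euler_step_def
    by (rule theI'[OF implicit_equation_ex1[OF diff Q zero infinity]]) (use E that in auto)
  have le: "?z \<omega> \<le> a \<longleftrightarrow> 0 < a \<and> c \<omega> \<le> a - f a * \<delta> \<omega>" if \<omega>: "\<omega> \<in> E" for \<omega>
  proof (cases "0 < a")
    case True
    have "c \<omega> = ?z \<omega> - f (?z \<omega>) * \<delta> \<omega>" "0 < ?z \<omega>"
      using z[OF \<omega>] by linarith+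
    moreover have "a - f a * \<delta> \<omega> < ?z \<omega> - f (?z \<omega>) * \<delta> \<omega>" if "a < ?z \<omega>"
      using implicit_map_strict_mono[OF diff Q] True that E[OF \<omega>] by blast
    moreover have "?z \<omega> - f (?z \<omega>) * \<delta> \<omega> < a - f a * \<delta> \<omega>" if "?z \<omega> < a"
      using implicit_map_strict_mono[OF diff Q] \<open>0 < ?z \<omega>\<close> that E[OF \<omega>] by blast
    ultimately show ?thesis
      using True by (metis linorder_less_linear order.asym order_le_less)
  qed (use z[OF \<omega>] in auto)
  have "{\<omega> \<in> space M. (if \<omega> \<in> E then ?z \<omega> else 0) \<le> a} =
      {\<omega> \<in> space M. if \<omega> \<in> E then 0 < a \<and> c \<omega> \<le> a - f a * \<delta> \<omega> else 0 \<le> a}"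
    using le by auto
  also have "\<dots> \<in> sets M"
    by measurable
  finally show "{\<omega> \<in> space M. (if \<omega> \<in> E then ?z \<omega> else 0) \<le> a} \<in> sets M" .
qed

context
  fixes am1 a0 a1 a2 a3 \<gamma> \<rho> :: real
  assumes pos: "am1 > 0" "a0 > 0" "a1 > 0" "a2 > 0" "a3 > 0" and \<rho>: "\<rho> > 1"
begin

lemma drift_differentiable:
  assumes "0 < x"
  shows "drift am1 a0 a1 a2 a3 \<gamma> \<rho> differentiable at x"
proof -
  have "\<exists>D. (drift am1 a0 a1 a2 a3 \<gamma> \<rho> has_real_derivative D) (at x)"
    unfolding drift_def[abs_def] using assms
    by (intro exI) (rule derivative_eq_intros refl | simp)+
  then show ?thesis
    by (auto simp: real_differentiable_def)
qed

text \<open>Near the origin, the term in \<open>x\<^sup>-\<^sup>1\<close> dominates the two negative terms, which are bounded.\<close>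

lemma drift_at_zero: "filterlim (drift am1 a0 a1 a2 a3 \<gamma> \<rho>) at_top (at_right 0)"
proof (rule filterlim_at_top_mono)
  let ?l = "\<lambda>x. - (\<rho> - 1) * (am1 + a1) + ((\<rho> - 1) * (\<rho> * a3\<^sup>2 / 2)) * inverse x"
  have "0 < (\<rho> - 1) * (\<rho> * a3\<^sup>2 / 2)"
    using pos \<rho> by simp
  then show "filterlim ?l at_top (at_right 0)"
    by (intro filterlim_tendsto_add_at_top[OF tendsto_const]
        filterlim_tendsto_pos_mult_at_top[OF tendsto_const] filterlim_inverse_at_top_right)
  have "\<forall>\<^sub>F x in at_right 0. x \<in> {0<..<1::real}"
    by (rule eventually_at_right_real) simp
  then show "\<forall>\<^sub>F x in at_right 0. ?l x \<le> drift am1 a0 a1 a2 a3 \<gamma> \<rho> x"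
  proof eventually_elim
    case (elim x)
    have "x powr ((\<rho> + 1) / (\<rho> - 1)) \<le> 1 powr ((\<rho> + 1) / (\<rho> - 1))"
      using elim \<rho> by (intro powr_mono2) auto
    then have "am1 * x powr ((\<rho> + 1) / (\<rho> - 1)) \<le> am1"
      using pos by simp
    moreover have "a1 * x \<le> a1"
      using elim pos by simp
    moreover have "0 \<le> a0 * x powr (\<rho> / (\<rho> - 1))" "0 \<le> a2 * x powr (- ((\<gamma> - \<rho>) / (\<rho> - 1)))"
      using pos by simp_all
    ultimately have "- (am1 + a1) + (\<rho> * a3\<^sup>2 / 2) * inverse x \<le>
       - am1 * x powr ((\<rho> + 1) / (\<rho> - 1)) + a0 * x powr (\<rho> / (\<rho> - 1)) - a1 * x
        + a2 * x powr (- ((\<gamma> - \<rho>) / (\<rho> - 1))) + (\<rho> * a3\<^sup>2 / 2) * inverse x"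
      by linarith
    then have "(\<rho> - 1) * (- (am1 + a1) + (\<rho> * a3\<^sup>2 / 2) * inverse x) \<le> drift am1 a0 a1 a2 a3 \<gamma> \<rho> x"
      unfolding drift_def using \<rho> by (intro mult_left_mono) auto
    then show ?case
      by (simp add: algebra_simps)
  qed
qed

text \<open>
  At infinity, the leading term absorbs the term with coefficient \<open>a0\<close> as soon as
  \<open>a0 / am1 \<le> x\<^bsup>1/(\<rho>-1)\<^esup>\<close>, and the powers with negative exponents are at most one.
\<close>

lemma drift_at_infinity:
  assumes "\<gamma> \<ge> \<rho>"
  shows "\<forall>\<^sub>F x in at_top. drift am1 a0 a1 a2 a3 \<gamma> \<rho> x \<le> (\<rho> - 1) * (a2 + \<rho> * a3\<^sup>2 / 2)"
  using eventually_ge_at_top[of "max 1 ((a0 / am1) powr (\<rho> - 1))"]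
proof eventually_elim
  case (elim x)
  let ?p = "\<rho> / (\<rho> - 1)"
  have x: "1 \<le> x" "(a0 / am1) powr (\<rho> - 1) \<le> x"
    using elim by auto
  have "((a0 / am1) powr (\<rho> - 1)) powr (1 / (\<rho> - 1)) \<le> x powr (1 / (\<rho> - 1))"
    using x \<rho> by (intro powr_mono2) auto
  then have "a0 / am1 \<le> x powr (1 / (\<rho> - 1))"
    using pos \<rho> by (simp add: powr_powr)
  then have "a0 \<le> am1 * x powr (1 / (\<rho> - 1))"
    using pos by (simp add: field_simps)
  then have "a0 * x powr ?p \<le> am1 * x powr (1 / (\<rho> - 1)) * x powr ?p"
    by (intro mult_right_mono) auto
  also have "\<dots> = am1 * x powr ((\<rho> + 1) / (\<rho> - 1))"
    by (simp add: powr_add[symmetric] add_divide_distrib add.commute)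
  finally have "a0 * x powr ?p \<le> am1 * x powr ((\<rho> + 1) / (\<rho> - 1))" .
  moreover have "x powr (- ((\<gamma> - \<rho>) / (\<rho> - 1))) \<le> x powr 0"
    using x assms \<rho> by (intro powr_mono) auto
  then have "a2 * x powr (- ((\<gamma> - \<rho>) / (\<rho> - 1))) \<le> a2"
    using pos x by (simp add: mult_le_cancel_left1)
  moreover have "(\<rho> * a3\<^sup>2 / 2) * inverse x \<le> (\<rho> * a3\<^sup>2 / 2) * 1"
    using x \<rho> by (intro mult_left_mono) (auto simp: inverse_le_1_iff)
  moreover have "0 \<le> a1 * x"
    using x pos by simp
  ultimately have "- am1 * x powr ((\<rho> + 1) / (\<rho> - 1)) + a0 * x powr ?p - a1 * x
      + a2 * x powr (- ((\<gamma> - \<rho>) / (\<rho> - 1))) + (\<rho> * a3\<^sup>2 / 2) * inverse x \<le> a2 + \<rho> * a3\<^sup>2 / 2"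
    by linarith
  then show ?case
    unfolding drift_def using \<rho> by (intro mult_left_mono) auto
qed

end

section \<open>Processes at random times\<close>

lemma (in complete_measure) borel_measurable_AE_eq:
  assumes "f \<in> borel_measurable M" "AE x in M. f x = g x"
  shows "g \<in> borel_measurable M"
proof (rule measurableI)
  fix A :: "'b set" assume A: "A \<in> sets borel"
  show "g -` A \<inter> space M \<in> sets M"
  proof (rule in_sets_AE)
    show "f -` A \<inter> space M \<in> sets M"
      using assms(1) A by (rule measurable_sets)
    show "AE x in M. x \<in> f -` A \<inter> space M \<longleftrightarrow> x \<in> g -` A \<inter> space M"
      using assms(2) by eventually_elim auto
  qed auto
qed simp

text \<open>
  Right-continuous paths allow the random time to be replaced by the next grid time
  \<open>j / n\<close>, which takes countably many values. Completeness takes care of the exceptional paths.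
\<close>

lemma (in complete_measure) borel_measurable_at_random_time:
  fixes X :: "real \<Rightarrow> 'a \<Rightarrow> real"
  assumes X: "\<And>t. 0 \<le> t \<Longrightarrow> X t \<in> borel_measurable M"
    and cont: "AE \<omega> in M. \<forall>t\<ge>0. continuous (at_right t) (\<lambda>s. X s \<omega>)"
    and \<tau>[measurable]: "\<tau> \<in> borel_measurable M"
    and \<tau>_nonneg: "\<And>\<omega>. \<omega> \<in> space M \<Longrightarrow> 0 \<le> \<tau> \<omega>"
  shows "(\<lambda>\<omega>. X (\<tau> \<omega>) \<omega>) \<in> borel_measurable M"
proof -
  define i where "i n \<omega> = nat \<lfloor>real (Suc n) * \<tau> \<omega>\<rfloor>" for n \<omega>
  define s where "s n \<omega> = (real (i n \<omega>) + 1) / real (Suc n)" for n \<omega>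
  have [measurable]: "i n \<in> measurable M (count_space UNIV)" for n
    unfolding i_def by measurable
  have meas: "(\<lambda>\<omega>. X (s n \<omega>) \<omega>) \<in> borel_measurable M" for n
    unfolding s_def
    by (rule measurable_compose_countable[of "\<lambda>j. X ((real j + 1) / real (Suc n))"]) (auto intro!: X)
  have s: "\<tau> \<omega> < s n \<omega>" "s n \<omega> \<le> \<tau> \<omega> + inverse (real (Suc n))" if "\<omega> \<in> space M" for n \<omega>
  proof -
    have "real (i n \<omega>) = of_int \<lfloor>real (Suc n) * \<tau> \<omega>\<rfloor>"
      unfolding i_def using \<tau>_nonneg[OF that] by (intro of_nat_nat) simp
    then have "real (Suc n) * \<tau> \<omega> < real (i n \<omega>) + 1" "real (i n \<omega>) \<le> real (Suc n) * \<tau> \<omega>"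
      by linarith+
    then have "\<tau> \<omega> * real (Suc n) < real (i n \<omega>) + 1"
      "real (i n \<omega>) + 1 \<le> (\<tau> \<omega> + inverse (real (Suc n))) * real (Suc n)"
      using left_inverse[of "real (Suc n)"] unfolding distrib_right by (simp_all add: mult.commute)
    then show "\<tau> \<omega> < s n \<omega>" "s n \<omega> \<le> \<tau> \<omega> + inverse (real (Suc n))"
      unfolding s_def by (simp_all add: pos_less_divide_eq pos_divide_le_eq)
  qed
  have "AE \<omega> in M. lim (\<lambda>n. X (s n \<omega>) \<omega>) = X (\<tau> \<omega>) \<omega>"
    using cont AE_space
  proof eventually_elim
    case (elim \<omega>)
    have "(\<lambda>n. \<tau> \<omega> + inverse (real (Suc n))) \<longlonglongrightarrow> \<tau> \<omega> + 0"
      by (intro tendsto_intros LIMSEQ_inverse_real_of_nat)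
    then have "(\<lambda>n. s n \<omega>) \<longlonglongrightarrow> \<tau> \<omega>"
      using s[OF elim(2)] by (intro tendsto_sandwich[of "\<lambda>_. \<tau> \<omega>" "\<lambda>n. s n \<omega>"])
        (auto intro!: always_eventually less_imp_le)
    then have "filterlim (\<lambda>n. s n \<omega>) (at_right (\<tau> \<omega>)) sequentially"
      using s(1)[OF elim(2)] by (simp add: filterlim_at less_imp_neq[THEN not_sym])
    moreover have "((\<lambda>t. X t \<omega>) \<longlongrightarrow> X (\<tau> \<omega>) \<omega>) (at_right (\<tau> \<omega>))"
      using elim(1) \<tau>_nonneg[OF elim(2)] unfolding continuous_within by blast
    ultimately have "(\<lambda>n. X (s n \<omega>) \<omega>) \<longlonglongrightarrow> X (\<tau> \<omega>) \<omega>"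
      by (rule filterlim_compose[rotated])
    then show ?case by (rule limI)
  qed
  then show ?thesis
    by (rule borel_measurable_AE_eq[OF borel_measurable_lim_metric[OF meas]])
qed

section \<open>The random mesh\<close>

locale random_mesh = prob_space P for P :: "'a measure" +
  fixes N :: "real \<Rightarrow> 'a \<Rightarrow> nat" and T :: real and M :: nat
  assumes N_measurable: "\<And>t. 0 \<le> t \<Longrightarrow> N t \<in> measurable P (count_space UNIV)"
    and path: "\<And>\<omega>. \<omega> \<in> space P \<Longrightarrow> counting_path (\<lambda>t. N t \<omega>)"
    and T_pos: "0 < T" and M_pos: "0 < M"
begin

lemma increment_measurable:
  assumes "0 \<le> s" "0 \<le> t"
  shows "(\<lambda>\<omega>. N t \<omega> - N s \<omega>) \<in> measurable P (count_space UNIV)"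
proof -
  note [measurable] = N_measurable[OF assms(1)] N_measurable[OF assms(2)]
  show ?thesis by measurable
qed

lemma increment_event:
  assumes "0 \<le> s" "0 \<le> t"
  shows "{\<omega> \<in> space P. N t \<omega> - N s \<omega> \<in> A} \<in> events"
  using increment_measurable[OF assms] by (rule measurable_sets_Collect) simp

text \<open>
  Whether a fixed cell contains a jump time can be read off from the values of \<open>N\<close> at its two ends,
  and \<open>card_ge_iff_occupied_cells\<close> reduces counting to such cells.
\<close>

lemma mesh_count_measurable:
  assumes t: "0 \<le> t" "t \<le> T"
  shows "{\<omega> \<in> space P. k \<le> card (mesh_set N T M \<omega> \<inter> {0<..t})} \<in> events"
proof (cases "t = 0")
  case True
  then show ?thesis by simp
next
  case False
  then have t: "0 < t" "t \<le> T" using t by auto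
  let ?grid = "(\<lambda>i. real i * (T / real M)) ` {0..M}"
  let ?Q = "\<lambda>n i \<omega>. mesh_set N T M \<omega> \<inter> uniform_cell t n i \<noteq> {}"
  have Q: "{\<omega> \<in> space P. ?Q n i \<omega>} \<in> events" if "i < n" for n i
  proof -
    let ?a = "t * i / n" and ?b = "t * Suc i / n"
    have ab: "0 \<le> ?a" "?a \<le> ?b" "?b \<le> T"
    proof -
      show "0 \<le> ?a" "?a \<le> ?b"
        using t by (auto intro!: divide_right_mono mult_left_mono)
      have "?b \<le> t"
        using t that by (simp add: divide_le_eq)
      then show "?b \<le> T" using t by simp
    qed
    have "{\<omega> \<in> space P. ?Q n i \<omega>} =
        {\<omega> \<in> space P. ?grid \<inter> uniform_cell t n i \<noteq> {} \<or> N ?b \<omega> - N ?a \<omega> \<in> {1..}}"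
    proof (intro Collect_cong conj_cong refl)
      fix \<omega> assume "\<omega> \<in> space P"
      then have "jump_times N T \<omega> \<inter> uniform_cell t n i \<noteq> {} \<longleftrightarrow> N ?a \<omega> < N ?b \<omega>"
        unfolding uniform_cell_def using path ab by (intro jump_in_cell_iff)
      then show "?Q n i \<omega> \<longleftrightarrow> ?grid \<inter> uniform_cell t n i \<noteq> {} \<or> N ?b \<omega> - N ?a \<omega> \<in> {1..}"
        unfolding mesh_set_def by (simp add: Suc_le_eq Int_Un_distrib2)
    qed
    also have "\<dots> \<in> events"
      using ab by (intro sets.sets_Collect_disj sets.sets_Collect_const increment_event) auto
    finally show ?thesis .
  qed
  have "{\<omega> \<in> space P. k \<le> card (mesh_set N T M \<omega> \<inter> {0<..t})} =
      {\<omega> \<in> space P. \<exists>n\<in>{0<..}. \<exists>I\<in>{I \<in> Pow {..<n}. card I = k}. \<forall>i\<in>I. ?Q n i \<omega>}"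
  proof (intro Collect_cong conj_cong refl)
    fix \<omega> assume "\<omega> \<in> space P"
    then have "finite (mesh_set N T M \<omega>)"
      using path T_pos M_pos by (intro finite_mesh_set)
    from card_ge_iff_occupied_cells[OF this t(1), of k]
    show "k \<le> card (mesh_set N T M \<omega> \<inter> {0<..t}) \<longleftrightarrow>
        (\<exists>n\<in>{0<..}. \<exists>I\<in>{I \<in> Pow {..<n}. card I = k}. \<forall>i\<in>I. ?Q n i \<omega>)"
      by (simp only: greaterThan_iff Bex_def)
  qed
  also have "\<dots> \<in> events"
  proof (intro sets.sets_Collect_countable_Ex' sets.sets_Collect_finite_Ex)
    fix n :: nat and I
    assume "I \<in> {I \<in> Pow {..<n}. card I = k}"
    then have I: "I \<subseteq> {..<n}" by simp
    show "{\<omega> \<in> space P. \<forall>i\<in>I. ?Q n i \<omega>} \<in> events"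
      using I by (intro sets.sets_Collect_finite_All Q) (auto intro: finite_subset)
  qed (auto intro!: countable_finite)
  finally show ?thesis .
qed

lemma le_mesh_last_measurable: "{\<omega> \<in> space P. k \<le> mesh_last N T M \<omega>} \<in> events"
proof -
  have "{\<omega> \<in> space P. k \<le> mesh_last N T M \<omega>} =
      {\<omega> \<in> space P. k \<le> card (mesh_set N T M \<omega> \<inter> {0<..T})}"
    using le_mesh_last_iff[of N, OF path T_pos M_pos] by auto
  then show ?thesis
    using mesh_count_measurable[of T k] T_pos by simp
qed

lemma less_mesh_last_measurable [measurable]: "Measurable.pred P (\<lambda>\<omega>. k < mesh_last N T M \<omega>)"
  using le_mesh_last_measurable[of "Suc k"] by (simp add: pred_def Suc_le_eq)

text \<open>Indices beyond the end of the mesh are sent to \<open>T\<close>, so as to have a total random time.\<close>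

definition capped_mesh_point :: "nat \<Rightarrow> 'a \<Rightarrow> real" where
  "capped_mesh_point k \<omega> = (if k \<le> mesh_last N T M \<omega> then mesh_point N T M k \<omega> else T)"

lemma capped_mesh_point_nonneg: "\<omega> \<in> space P \<Longrightarrow> 0 \<le> capped_mesh_point k \<omega>"
  using mesh_point_bounds(1)[of N, OF path T_pos M_pos] T_pos by (auto simp: capped_mesh_point_def)

lemma capped_mesh_point_measurable [measurable]: "capped_mesh_point k \<in> borel_measurable P"
proof (rule borel_measurableI_le)
  fix a :: real
  consider "a < 0" | "0 \<le> a" "a < T" | "T \<le> a" by linarith
  then show "{\<omega> \<in> space P. capped_mesh_point k \<omega> \<le> a} \<in> events"
  proof cases
    case 1
    then have "\<not> capped_mesh_point k \<omega> \<le> a" if "\<omega> \<in> space P" for \<omega>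
      using capped_mesh_point_nonneg[OF that, of k] by linarith
    then have "{\<omega> \<in> space P. capped_mesh_point k \<omega> \<le> a} = {}"
      by blast
    then show ?thesis by (simp only: sets.empty_sets)
  next
    case 2
    have "capped_mesh_point k \<omega> \<le> a \<longleftrightarrow> k \<le> card (mesh_set N T M \<omega> \<inter> {0<..a})"
      if \<omega>: "\<omega> \<in> space P" for \<omega>
    proof (cases "k \<le> mesh_last N T M \<omega>")
      case True
      then show ?thesis
        using mesh_point_le_iff[of N, OF path[OF \<omega>] T_pos M_pos True 2(1)]
        by (simp add: capped_mesh_point_def)
    next
      case False
      have "card (mesh_set N T M \<omega> \<inter> {0<..a}) \<le> card (mesh_set N T M \<omega> \<inter> {0<..T})"
        using 2 finite_mesh_set[of N, OF path[OF \<omega>] T_pos M_pos] by (intro card_mono) auto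
      then show ?thesis
        using False 2 le_mesh_last_iff[of N, OF path[OF \<omega>] T_pos M_pos, of k]
        by (simp add: capped_mesh_point_def)
    qed
    then have "{\<omega> \<in> space P. capped_mesh_point k \<omega> \<le> a} =
        {\<omega> \<in> space P. k \<le> card (mesh_set N T M \<omega> \<inter> {0<..a})}"
      by blast
    then show ?thesis
      using mesh_count_measurable[of a k] 2 by simp
  next
    case 3
    have "capped_mesh_point k \<omega> \<le> a" if "\<omega> \<in> space P" for \<omega>
      using mesh_point_bounds(2)[of N, OF path[OF that] T_pos M_pos, of k] 3
      by (auto simp: capped_mesh_point_def)
    then have "{\<omega> \<in> space P. capped_mesh_point k \<omega> \<le> a} = space P"
      by blast
    then show ?thesis by simp
  qed
qed

end

section \<open>Jumps of a Poisson process\<close>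

lemma prob_poisson_ge_2_le:
  assumes "0 < \<mu>"
  shows "measure (measure_pmf (poisson_pmf \<mu>)) {2..} \<le> \<mu>\<^sup>2"
proof -
  have "{2..} = space (measure_pmf (poisson_pmf \<mu>)) - {0, 1::nat}"
    by auto
  then have "measure (measure_pmf (poisson_pmf \<mu>)) {2..} =
      1 - measure (measure_pmf (poisson_pmf \<mu>)) {0, 1}"
    by (simp only: measure_pmf.prob_compl sets_measure_pmf UNIV_I)
  also have "\<dots> = 1 - (1 + \<mu>) * exp (- \<mu>)"
    using assms by (simp add: measure_measure_pmf_finite algebra_simps)
  also have "\<dots> \<le> 1 - (1 + \<mu>) * (1 - \<mu>)"
    using assms exp_ge_add_one_self[of "- \<mu>"] by (intro diff_left_mono mult_left_mono) auto
  also have "\<dots> = \<mu>\<^sup>2"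
    by (simp add: algebra_simps power2_eq_square)
  finally show ?thesis .
qed

lemma prob_poisson_nonzero_pos:
  assumes "0 < \<mu>"
  shows "0 < measure (measure_pmf (poisson_pmf \<mu>)) (- {0})"
proof -
  have "measure (measure_pmf (poisson_pmf \<mu>)) (space (measure_pmf (poisson_pmf \<mu>)) - {0}) =
      1 - measure (measure_pmf (poisson_pmf \<mu>)) {0}"
    by (rule measure_pmf.prob_compl) simp
  also have "\<dots> = 1 - exp (- \<mu>)"
    using assms by (simp add: measure_pmf_single)
  finally show ?thesis
    using assms by (simp add: Compl_eq_Diff_UNIV)
qed

locale poisson_mesh = random_mesh P N T M + filtration "space P" \<F>
  for P :: "'a measure" and N T M and \<F> :: "real \<Rightarrow> 'a measure" +
  fixes rate :: real
  assumes rate_pos: "0 < rate"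
    and \<F>_subset: "\<And>t. sets (\<F> t) \<subseteq> events"
    and adapted: "\<And>t. 0 \<le> t \<Longrightarrow> N t \<in> measurable (\<F> t) (count_space UNIV)"
    and increment_indep: "\<And>s t. 0 \<le> s \<Longrightarrow> s < t \<Longrightarrow>
      indep_set (sets (\<F> s))
        (sets (vimage_algebra (space P) (\<lambda>\<omega>. N t \<omega> - N s \<omega>) (count_space UNIV)))"
    and increment_law: "\<And>s t. 0 \<le> s \<Longrightarrow> s < t \<Longrightarrow>
      distr P (count_space UNIV) (\<lambda>\<omega>. N t \<omega> - N s \<omega>) = measure_pmf (poisson_pmf (rate * (t - s)))"
begin

lemma prob_increment:
  assumes "0 \<le> s" "s < t"
  shows "prob {\<omega> \<in> space P. N t \<omega> - N s \<omega> \<in> A} =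
    measure (measure_pmf (poisson_pmf (rate * (t - s)))) A"
proof -
  have "measure (distr P (count_space UNIV) (\<lambda>\<omega>. N t \<omega> - N s \<omega>)) A =
      prob ((\<lambda>\<omega>. N t \<omega> - N s \<omega>) -` A \<inter> space P)"
    using assms by (intro measure_distr increment_measurable) auto
  moreover have "(\<lambda>\<omega>. N t \<omega> - N s \<omega>) -` A \<inter> space P = {\<omega> \<in> space P. N t \<omega> - N s \<omega> \<in> A}"
    by auto
  ultimately show ?thesis
    using increment_law[OF assms] by simp
qed

text \<open>
  A jump of size at least two makes the cell that contains it grow by at least two, for every fine
  uniform partition.  For \<open>n\<close> cells, this has probability at most \<open>n * (rate * T / n)\<^sup>2\<close>, which vanishes as
  \<open>n\<close> grows.
\<close>

lemma AE_unit_jumps: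
  "AE \<omega> in P. \<forall>k < mesh_last N T M \<omega>.
     N (mesh_point N T M (k + 1) \<omega>) \<omega> - N (mesh_point N T M k \<omega>) \<omega> \<le> 1"
proof -
  let ?s = "\<lambda>n i. T * real i / real n"
  define A where "A n = (\<Union>i<n. {\<omega> \<in> space P. N (?s n (Suc i)) \<omega> - N (?s n i) \<omega> \<in> {2..}})" for n
  have s: "0 \<le> ?s n i" for n i
    using T_pos by simp
  have cell: "{\<omega> \<in> space P. N (?s n (Suc i)) \<omega> - N (?s n i) \<omega> \<in> {2..}} \<in> events" for n i
    using s by (intro increment_event)
  have A: "A n \<in> events" for n
    unfolding A_def using cell by (intro sets.finite_UN) auto
  have prob_A: "prob (A n) \<le> (rate * T)\<^sup>2 / n" if n: "0 < n" for n
  proof -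
    have less: "?s n i < ?s n (Suc i)" for i
      using T_pos n by (intro divide_strict_right_mono mult_strict_left_mono) auto
    have "prob (A n) \<le> (\<Sum>i<n. prob {\<omega> \<in> space P. N (?s n (Suc i)) \<omega> - N (?s n i) \<omega> \<in> {2..}})"
      unfolding A_def using cell by (intro finite_measure_subadditive_finite) auto
    also have "\<dots> \<le> (\<Sum>i<n. (rate * (T / n))\<^sup>2)"
    proof (rule sum_mono)
      fix i
      have "?s n (Suc i) - ?s n i = T / n"
        by (simp add: diff_divide_distrib[symmetric] algebra_simps)
      moreover have "0 < rate * (T / n)" using T_pos rate_pos n by simp
      ultimately show "prob {\<omega> \<in> space P. N (?s n (Suc i)) \<omega> - N (?s n i) \<omega> \<in> {2..}}
          \<le> (rate * (T / n))\<^sup>2"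
        using prob_increment[of "?s n i" "?s n (Suc i)" "{2..}"] s[of i n]
          prob_poisson_ge_2_le[of "rate * (T / n)"] less[of i] by (simp del: of_nat_Suc)
    qed
    also have "\<dots> = (rate * T)\<^sup>2 / n"
      using n by (simp add: power2_eq_square field_simps)
    finally show ?thesis .
  qed
  have "AE \<omega> in P. \<forall>m. \<exists>n\<ge>m. \<omega> \<notin> A n"
    unfolding AE_all_countable
  proof
    fix m
    let ?B = "\<Inter>n\<in>{m..}. A n"
    have B: "?B \<in> events"
      using A by (intro sets.countable_INT) auto
    have "(\<lambda>n. (rate * T)\<^sup>2 / real n) \<longlonglongrightarrow> 0"
      by (rule lim_const_over_n)
    then have "prob ?B \<le> 0"
    proof (rule tendsto_lowerbound)
      show "\<forall>\<^sub>F n in sequentially. prob ?B \<le> (rate * T)\<^sup>2 / real n"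
        using eventually_ge_at_top[of "max 1 m"]
      proof eventually_elim
        case (elim n)
        then have "prob ?B \<le> prob (A n)"
          using A by (intro finite_measure_mono) auto
        then show ?case using prob_A[of n] elim by simp
      qed
    qed simp
    then have "?B \<in> null_sets P"
      using B measure_nonneg[of P ?B]
      by (intro null_setsI) (simp_all only: emeasure_eq_measure ennreal_eq_0_iff)
    from AE_not_in[OF this] show "AE \<omega> in P. \<exists>n\<ge>m. \<omega> \<notin> A n"
      by eventually_elim auto
  qed
  then show ?thesis
    using AE_space
  proof eventually_elim
    case (elim \<omega>)
    note path = path[OF elim(2)]
    show ?case
    proof (intro allI impI, rule ccontr)
      fix k assume k: "k < mesh_last N T M \<omega>"
      let ?t = "mesh_point N T M k \<omega>" and ?t' = "mesh_point N T M (k + 1) \<omega>"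
      assume "\<not> N ?t' \<omega> - N ?t \<omega> \<le> 1"
      then have big: "2 \<le> N ?t' \<omega> - N ?t \<omega>" by simp
      have t: "0 \<le> ?t" "?t < ?t'" "?t' \<le> T"
        using mesh_point_bounds[of N, OF path T_pos M_pos, of k]
          mesh_point_bounds[of N, OF path T_pos M_pos, of "k + 1"]
          mesh_point_less[of N, OF path T_pos M_pos k] k by auto
      obtain m :: nat where m: "T / (?t' - ?t) < m"
        using reals_Archimedean2 by blast
      obtain n where n: "m \<le> n" "\<omega> \<notin> A n"
        using elim(1) by blast
      have fine: "T / (?t' - ?t) < n"
        using m n by simp
      have n0: "0 < n"
        using fine T_pos t by (metis diff_gt_0_iff_gt divide_pos_pos not_gr_zero of_nat_0 order.asym)
      have fine: "T / n < ?t' - ?t"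
        using fine t n0 by (simp add: field_simps)
      obtain i where i: "i < n" "?t' \<in> uniform_cell T n i"
        using uniform_cell_exists[of ?t' T n] t n0 by auto
      have cell: "?s n i < ?t'" "?t' \<le> ?s n (Suc i)" "?s n (Suc i) = ?s n i + T / n"
        using i(2) by (auto simp: uniform_cell_def distrib_left add_divide_distrib)
      then have "?t \<le> ?s n i"
        using fine by linarith
      then have "N (?s n i) \<omega> = N ?t \<omega>"
        using counting_path_before_mesh_point[of N, OF path T_pos M_pos k] cell by blast
      moreover have "N ?t' \<omega> \<le> N (?s n (Suc i)) \<omega>"
        using counting_path_mono[OF path, of ?t'] t cell by auto
      ultimately have "\<omega> \<in> A n"
        unfolding A_def using big i(1) elim(2) by (intro UN_I[of i]) auto
      then show False using n by simp
    qed
  qed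
qed

text \<open>
  The conditional probability of an event given a null event is \<open>0\<close> by convention, so every index
  must occur with positive probability.  By independence, \<open>N\<close> increases in each of \<open>k + 1\<close> disjoint
  cells with positive probability, and then there are at least \<open>k + 1\<close> jump times.
\<close>

lemma prob_less_mesh_last_pos: "0 < prob {\<omega> \<in> space P. k < mesh_last N T M \<omega>}"
proof -
  define n where "n = Suc k"
  let ?s = "\<lambda>i. T * real i / real n"
  let ?D = "\<lambda>i \<omega>. N (?s (Suc i)) \<omega> - N (?s i) \<omega>"
  define C where "C m = {\<omega> \<in> space P. \<forall>i<m. ?D i \<omega> \<in> - {0}}" for m
  have s: "0 \<le> ?s i" "?s i < ?s (Suc i)" for i
    using T_pos by (auto simp: n_def divide_strict_right_mono)
  have s_mono: "?s i \<le> ?s j" if "i \<le> j" for i j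
    using that T_pos by (auto intro!: divide_right_mono mult_left_mono)
  have C: "C m \<in> sets (\<F> (?s m))" for m
  proof -
    have N_adapted: "N (?s i) \<in> measurable (\<F> (?s m)) (count_space UNIV)" if "i \<le> m" for i
      using measurable_mono[OF order.refl _ sets_F_mono[OF s_mono[OF that]]]
        adapted[OF s(1), of i] by (auto simp: space_F)
    have D: "?D i \<in> measurable (\<F> (?s m)) (count_space UNIV)" if "i < m" for i
    proof -
      have [measurable]: "N (?s i) \<in> measurable (\<F> (?s m)) (count_space UNIV)"
        "N (?s (Suc i)) \<in> measurable (\<F> (?s m)) (count_space UNIV)"
        using that by (auto intro!: N_adapted simp del: of_nat_Suc)
      show ?thesis by measurable
    qed
    have "{\<omega> \<in> space (\<F> (?s m)). \<forall>i\<in>{..<m}. ?D i \<omega> \<in> - {0}} \<in> sets (\<F> (?s m))"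
    proof (rule sets.sets_Collect_finite_All)
      fix i assume "i \<in> {..<m}"
      then show "{\<omega> \<in> space (\<F> (?s m)). ?D i \<omega> \<in> - {0}} \<in> sets (\<F> (?s m))"
        by (intro measurable_sets_Collect[OF D]) auto
    qed simp
    then show ?thesis
      unfolding C_def space_F Ball_def lessThan_iff .
  qed
  have "0 < prob (C m)" for m
  proof (induction m)
    case 0
    then show ?case by (simp add: C_def prob_space)
  next
    case (Suc m)
    let ?E = "{\<omega> \<in> space P. ?D m \<omega> \<in> - {0}}"
    have "?E = ?D m -` (- {0}) \<inter> space P" by auto
    then have "?E \<in> sets (vimage_algebra (space P) (?D m) (count_space UNIV))"
      by (simp only: in_vimage_algebra sets_count_space UNIV_I Pow_UNIV)
    then have "prob (C m \<inter> ?E) = prob (C m) * prob ?E"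
      by (intro indep_setD[OF increment_indep[OF s] C])
    moreover have "0 < prob ?E"
      unfolding prob_increment[OF s] using rate_pos s[of m] by (intro prob_poisson_nonzero_pos) auto
    moreover have "C (Suc m) = C m \<inter> ?E"
      by (auto simp: C_def less_Suc_eq)
    ultimately show ?case using Suc by simp
  qed
  moreover have "C n \<subseteq> {\<omega> \<in> space P. k < mesh_last N T M \<omega>}"
  proof
    fix \<omega> assume "\<omega> \<in> C n"
    then have \<omega>: "\<omega> \<in> space P" and D: "\<And>i. i < n \<Longrightarrow> N (?s i) \<omega> < N (?s (Suc i)) \<omega>"
      by (auto simp: C_def)
    have "mesh_set N T M \<omega> \<inter> uniform_cell T n i \<noteq> {}" if "i < n" for i
    proof -
      have "?s (Suc i) \<le> T"
        using that T_pos by (simp add: divide_le_eq)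
      then have "jump_times N T \<omega> \<inter> uniform_cell T n i \<noteq> {}"
        unfolding uniform_cell_def using D[OF that] s[of i]
        by (subst jump_in_cell_iff[of N, OF path[OF \<omega>]]) auto
      then show ?thesis by (auto simp: mesh_set_def)
    qed
    then have "n \<le> card (mesh_set N T M \<omega> \<inter> {0<..T})"
      using card_ge_iff_occupied_cells[OF finite_mesh_set[of N, OF path[OF \<omega>] T_pos M_pos] T_pos, of n]
      by (auto simp: n_def intro!: exI[of _ n] bexI[of _ "{..<n}"])
    then show "\<omega> \<in> {\<omega> \<in> space P. k < mesh_last N T M \<omega>}"
      using \<omega> le_mesh_last_iff[of N, OF path[OF \<omega>] T_pos M_pos, of n] by (simp add: n_def)
  qed
  then have "prob (C n) \<le> prob {\<omega> \<in> space P. k < mesh_last N T M \<omega>}"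
    by (rule finite_measure_mono) simp
  ultimately show ?thesis
    using order.strict_trans2 by blast
qed

end

section \<open>The jump-adapted backward Euler scheme\<close>

locale euler_scheme = random_mesh P N T M + complete_measure P for P :: "'a measure" and N T M +
  fixes W :: "real \<Rightarrow> 'a \<Rightarrow> real" and f h :: "real \<Rightarrow> real" and a3 \<rho> x0 Q B :: real
  assumes W_measurable: "\<And>t. 0 \<le> t \<Longrightarrow> W t \<in> borel_measurable P"
    and W_continuous: "AE \<omega> in P. continuous_on {0..} (\<lambda>t. W t \<omega>)"
    and f_differentiable: "\<And>x. 0 < x \<Longrightarrow> f differentiable at x"
    and deriv_f_le: "\<And>x. 0 < x \<Longrightarrow> deriv f x \<le> Q"
    and f_at_zero: "filterlim f at_top (at_right 0)"
    and f_at_infinity: "\<forall>\<^sub>F x in at_top. f x \<le> B"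
    and Q_nonneg: "0 \<le> Q" and step_size: "Q * (T / real M) < 1"
    and h_measurable [measurable]: "h \<in> borel_measurable borel"
    and jump_pos: "\<And>y. 0 < y \<Longrightarrow> 0 < y + h y"
    and x0_pos: "0 < x0"
begin

definition left_value :: "nat \<Rightarrow> real \<Rightarrow> 'a \<Rightarrow> real" where
  "left_value k z \<omega> = (if k < mesh_last N T M \<omega>
     then implicit_euler_step f (capped_mesh_point (Suc k) \<omega> - capped_mesh_point k \<omega>)
       (z + (1 - \<rho>) * a3 * (W (capped_mesh_point (Suc k) \<omega>) \<omega> - W (capped_mesh_point k \<omega>) \<omega>))
     else 0)"

definition jump_value :: "real \<Rightarrow> real \<Rightarrow> real" where
  "jump_value z dN =
     z + ((z powr (1 / (1 - \<rho>)) + h (z powr (1 / (1 - \<rho>)))) powr (1 - \<rho>) - z) * dN"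

primrec scheme :: "nat \<Rightarrow> 'a \<Rightarrow> real" where
  "scheme 0 \<omega> = x0 powr (1 - \<rho>)"
| "scheme (Suc k) \<omega> = jump_value (left_value k (scheme k \<omega>) \<omega>)
     (real (N (capped_mesh_point (Suc k) \<omega>) \<omega>) - real (N (capped_mesh_point k \<omega>) \<omega>))"

text \<open>The value at \<open>t\<^sub>k-\<close> is produced in the step that starts at \<open>t\<^bsub>k-1\<^esub>\<close>.\<close>

definition scheme_left :: "nat \<Rightarrow> 'a \<Rightarrow> real" where
  "scheme_left k \<omega> = left_value (k - 1) (scheme (k - 1) \<omega>) \<omega>"

lemma capped_step:
  assumes "\<omega> \<in> space P" "k < mesh_last N T M \<omega>"
  shows "0 < capped_mesh_point (Suc k) \<omega> - capped_mesh_point k \<omega>"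
    and "Q * (capped_mesh_point (Suc k) \<omega> - capped_mesh_point k \<omega>) < 1"
proof -
  let ?d = "capped_mesh_point (Suc k) \<omega> - capped_mesh_point k \<omega>"
  note mesh = path[OF assms(1)] T_pos M_pos assms(2)
  show "0 < ?d"
    using mesh_point_less[of N, OF mesh] assms(2) by (simp add: capped_mesh_point_def)
  have "?d \<le> T / M"
    using mesh_step_le[of N, OF mesh] assms(2) by (simp add: capped_mesh_point_def)
  then have "Q * ?d \<le> Q * (T / M)"
    using Q_nonneg by (rule mult_left_mono)
  then show "Q * ?d < 1"
    using step_size by simp
qed

lemma left_value_iff:
  assumes "\<omega> \<in> space P" "k < mesh_last N T M \<omega>"
  shows "x = left_value k z \<omega> \<longleftrightarrow>
    0 < x \<and> x = z + f x * (mesh_point N T M (k + 1) \<omega> - mesh_point N T M k \<omega>)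
      + (1 - \<rho>) * a3 * (W (mesh_point N T M (k + 1) \<omega>) \<omega> - W (mesh_point N T M k \<omega>) \<omega>)"
proof -
  let ?d = "capped_mesh_point (Suc k) \<omega> - capped_mesh_point k \<omega>"
  let ?c = "z + (1 - \<rho>) * a3 *
    (W (capped_mesh_point (Suc k) \<omega>) \<omega> - W (capped_mesh_point k \<omega>) \<omega>)"
  have ex1: "\<exists>!x. 0 < x \<and> x = ?c + f x * ?d"
    using implicit_equation_ex1[OF f_differentiable deriv_f_le f_at_zero f_at_infinity
        capped_step[OF assms]] .
  then have "x = left_value k z \<omega> \<longleftrightarrow> 0 < x \<and> x = ?c + f x * ?d"
    using theI'[OF ex1] assms(2) unfolding left_value_def implicit_euler_step_def by auto
  then show ?thesis
    using assms(2) by (simp add: capped_mesh_point_def add.assoc add.commute add.left_commute)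
qed

lemma W_at_mesh_measurable [measurable]: "(\<lambda>\<omega>. W (capped_mesh_point k \<omega>) \<omega>) \<in> borel_measurable P"
proof (rule borel_measurable_at_random_time[OF W_measurable])
  show "AE \<omega> in P. \<forall>t\<ge>0. continuous (at_right t) (\<lambda>s. W s \<omega>)"
    using W_continuous
  proof eventually_elim
    case (elim \<omega>)
    then show ?case
      by (auto simp: continuous_on_eq_continuous_within
          intro: continuous_within_subset[where t="{_<..}"])
  qed
qed (auto intro: capped_mesh_point_nonneg)

lemma N_at_mesh_measurable [measurable]:
  "(\<lambda>\<omega>. real (N (capped_mesh_point k \<omega>) \<omega>)) \<in> borel_measurable P"
proof (rule borel_measurable_at_random_time[of "\<lambda>t \<omega>. real (N t \<omega>)"])
  fix t :: real assume "0 \<le> t"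
  note [measurable] = N_measurable[OF this]
  show "(\<lambda>\<omega>. real (N t \<omega>)) \<in> borel_measurable P" by measurable
next
  show "AE \<omega> in P. \<forall>t\<ge>0. continuous (at_right t) (\<lambda>s. real (N s \<omega>))"
    using path by (intro AE_I2) (auto simp: counting_path_def)
qed (auto intro: capped_mesh_point_nonneg)

lemma left_value_measurable:
  assumes [measurable]: "z \<in> borel_measurable P"
  shows "(\<lambda>\<omega>. left_value k (z \<omega>) \<omega>) \<in> borel_measurable P"
proof -
  let ?E = "{\<omega> \<in> space P. k < mesh_last N T M \<omega>}"
  have "(\<lambda>\<omega>. if \<omega> \<in> ?E
      then implicit_euler_step f (capped_mesh_point (Suc k) \<omega> - capped_mesh_point k \<omega>)
        (z \<omega> + (1 - \<rho>) * a3 * (W (capped_mesh_point (Suc k) \<omega>) \<omega> - W (capped_mesh_point k \<omega>) \<omega>))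
      else 0) \<in> borel_measurable P"
    by (rule borel_measurable_implicit_euler_step[OF f_differentiable deriv_f_le f_at_zero
          f_at_infinity]) (use capped_step in auto)
  also have "?this \<longleftrightarrow> ?thesis"
    by (intro measurable_cong) (simp add: left_value_def)
  finally show ?thesis .
qed

lemma scheme_measurable: "scheme k \<in> borel_measurable P"
proof (induction k)
  case 0
  show ?case by simp
next
  case (Suc k)
  note [measurable] = left_value_measurable[OF Suc]
  show ?case
    unfolding scheme.simps(2)[abs_def] jump_value_def by measurable
qed

lemma scheme_left_measurable: "scheme_left k \<in> borel_measurable P"
  unfolding scheme_left_def[abs_def] by (intro left_value_measurable scheme_measurable)

lemma scheme_solution: "backward_euler_solution P W N T M f h a3 \<rho> x0 scheme_left scheme"
  unfolding backward_euler_solution_def Let_def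
proof (intro ballI conjI allI impI)
  fix \<omega> k assume \<omega>: "\<omega> \<in> space P" "k < mesh_last N T M \<omega>"
  have "scheme_left (k + 1) \<omega> = left_value k (scheme k \<omega>) \<omega>"
    by (simp add: scheme_left_def)
  note left = this[unfolded left_value_iff[OF \<omega>]]
  show "0 < scheme_left (k + 1) \<omega>"
    using left by blast
  show "scheme_left (k + 1) \<omega> = scheme k \<omega>
      + f (scheme_left (k + 1) \<omega>) * (mesh_point N T M (k + 1) \<omega> - mesh_point N T M k \<omega>)
      + (1 - \<rho>) * a3 * (W (mesh_point N T M (k + 1) \<omega>) \<omega> - W (mesh_point N T M k \<omega>) \<omega>)"
    using left by blast
qed (simp_all add: scheme_left_def jump_value_def capped_mesh_point_def)

text \<open>
  Besides uniqueness, the comparison with \<^const>\<open>scheme\<close> makes events about an arbitrary solution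
  measurable, although its definition speaks about single paths only.
\<close>

lemma solution_eq_scheme:
  assumes sol: "backward_euler_solution P W N T M f h a3 \<rho> x0 Zm Z" and \<omega>: "\<omega> \<in> space P"
  shows "k \<le> mesh_last N T M \<omega> \<Longrightarrow> Z k \<omega> = scheme k \<omega>"
    and "k < mesh_last N T M \<omega> \<Longrightarrow> Zm (Suc k) \<omega> = scheme_left (Suc k) \<omega>"
proof -
  have left: "Zm (Suc k) \<omega> = left_value k (Z k \<omega>) \<omega>" if k: "k < mesh_last N T M \<omega>" for k
    unfolding left_value_iff[OF \<omega> k]
    using sol \<omega> k unfolding backward_euler_solution_def Let_def by simp
  have jump: "Z (Suc k) \<omega> = jump_value (Zm (Suc k) \<omega>)
      (real (N (capped_mesh_point (Suc k) \<omega>) \<omega>) - real (N (capped_mesh_point k \<omega>) \<omega>))"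
    if k: "k < mesh_last N T M \<omega>" for k
    using sol \<omega> k unfolding backward_euler_solution_def Let_def jump_value_def
    by (simp add: capped_mesh_point_def)
  have Z: "Z k \<omega> = scheme k \<omega>" if "k \<le> mesh_last N T M \<omega>" for k
    using that
  proof (induction k)
    case 0
    show ?case
      using sol \<omega> by (simp add: backward_euler_solution_def)
  next
    case (Suc k)
    then show ?case
      by (simp add: jump left)
  qed
  then show "k \<le> mesh_last N T M \<omega> \<Longrightarrow> Z k \<omega> = scheme k \<omega>" .
  show "Zm (Suc k) \<omega> = scheme_left (Suc k) \<omega>" if "k < mesh_last N T M \<omega>"
    using that Z[of k] by (simp add: left scheme_left_def)
qed

text \<open>
  The left limit is positive because it solves the implicit equation.  Without a jump it is kept, and a
  unit jump replaces it by a power of the positive number \<open>y + h y\<close>.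
\<close>

lemma scheme_pos:
  assumes \<omega>: "\<omega> \<in> space P"
    and unit: "\<forall>k < mesh_last N T M \<omega>.
      N (mesh_point N T M (k + 1) \<omega>) \<omega> - N (mesh_point N T M k \<omega>) \<omega> \<le> 1"
    and k: "k \<le> mesh_last N T M \<omega>"
  shows "0 < scheme k \<omega>"
proof (cases k)
  case 0
  then show ?thesis using x0_pos by simp
next
  case (Suc j)
  then have j: "j < mesh_last N T M \<omega>" using k by simp
  let ?z = "left_value j (scheme j \<omega>) \<omega>"
  let ?n = "N (mesh_point N T M j \<omega>) \<omega>" and ?n' = "N (mesh_point N T M (j + 1) \<omega>) \<omega>"
  have z: "0 < ?z"
    using left_value_iff[OF \<omega> j, of ?z "scheme j \<omega>"] by blast
  then have y: "0 < ?z powr (1 / (1 - \<rho>)) + h (?z powr (1 / (1 - \<rho>)))"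
    by (intro jump_pos) simp
  have "?n \<le> ?n'"
    using mesh_point_less[of N, OF path[OF \<omega>] T_pos M_pos j]
      mesh_point_bounds(1)[of N, OF path[OF \<omega>] T_pos M_pos, of j] j
    by (intro counting_path_mono[OF path[OF \<omega>]]) auto
  moreover have "?n' - ?n \<le> 1"
    using unit j by blast
  ultimately have "?n' = ?n \<or> ?n' = Suc ?n"
    by linarith
  then have "real ?n' - real ?n = 0 \<or> real ?n' - real ?n = 1"
    by auto
  then have "0 < jump_value ?z (real ?n' - real ?n)"
    using z y by (auto simp: jump_value_def)
  then show ?thesis
    using j Suc by (simp add: capped_mesh_point_def)
qed

end

section \<open>Solvability and positivity\<close>

theorem lemma3p1:
  fixes P :: "'a measure" and \<F> :: "real \<Rightarrow> 'a measure"
    and W :: "real \<Rightarrow> 'a \<Rightarrow> real" and N :: "real \<Rightarrow> 'a \<Rightarrow> nat"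
    and T rate am1 a0 a1 a2 a3 \<gamma> \<rho> x0 Q :: real and M :: nat
    and h :: "real \<Rightarrow> real"
  defines "f \<equiv> drift am1 a0 a1 a2 a3 \<gamma> \<rho>"
  assumes "complete_filtered_prob_space P \<F>"
    and "wiener_process P \<F> W"
    and "rate > 0" and "poisson_process P \<F> rate N"
    and "independent_processes P W N"
    and "T > 0" and "M > 0"
    and "am1 > 0" and "a0 > 0" and "a1 > 0" and "a2 > 0" and "a3 > 0"
    and "\<gamma> > 1" and "\<rho> > 1" and "x0 > 0"
    and "condition_A h"
    and "\<gamma> \<ge> 2 * \<rho> - 1"
    and "Q \<ge> 0" and "\<And>x. x > 0 \<Longrightarrow> deriv f x \<le> Q"
    and "Q * (T / real M) < 1"
  shows "(\<exists>Zm Z. backward_euler_solution P W N T M f h a3 \<rho> x0 Zm Z \<and>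
            (\<forall>k. Zm k \<in> borel_measurable P \<and> Z k \<in> borel_measurable P)) \<and>
         (\<forall>Zm Z Zm' Z'.
            backward_euler_solution P W N T M f h a3 \<rho> x0 Zm Z \<longrightarrow>
            backward_euler_solution P W N T M f h a3 \<rho> x0 Zm' Z' \<longrightarrow>
            (\<forall>\<omega>\<in>space P.
               (\<forall>k\<le>mesh_last N T M \<omega>. Z k \<omega> = Z' k \<omega>) \<and>
               (\<forall>k\<in>{1..mesh_last N T M \<omega>}. Zm k \<omega> = Zm' k \<omega>))) \<and>
         (\<forall>Zm Z. backward_euler_solution P W N T M f h a3 \<rho> x0 Zm Z \<longrightarrow>
            (\<forall>k. \<P>(\<omega> in P. Z (k + 1) \<omega> > 0 \<bar> k < mesh_last N T M \<omega> \<and> Z k \<omega> > 0) = 1))"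
proof -
  note F = assms(2)[unfolded complete_filtered_prob_space_def]
  note W = assms(3)[unfolded wiener_process_def]
  note N = assms(5)[unfolded poisson_process_def]
  have subalgebra: "X \<in> measurable P K" if "X \<in> measurable (\<F> t) K" for X :: "'a \<Rightarrow> 'c" and K t
  proof -
    have "space (\<F> t) = space P" "sets (\<F> t) \<subseteq> sets P"
      using F filtration.space_F by blast+
    then show ?thesis
      using that measurable_mono[OF order.refl refl, of "\<F> t" P K] by auto
  qed
  interpret poisson_mesh P N T M \<F> rate
  proof (intro poisson_mesh.intro random_mesh.intro random_mesh_axioms.intro
      poisson_mesh_axioms.intro)
    show "prob_space P" "filtration (space P) \<F>" using F by blast+
    show "N t \<in> measurable P (count_space UNIV)" if "0 \<le> t" for t
      using that N subalgebra[of "N t" t] by blast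
    show "counting_path (\<lambda>t. N t \<omega>)" if "\<omega> \<in> space P" for \<omega>
      using that N by (auto simp: counting_path_def)
  qed (use F N assms in auto)
  interpret euler_scheme P N T M W f h a3 \<rho> x0 Q "(\<rho> - 1) * (a2 + \<rho> * a3\<^sup>2 / 2)"
  proof (intro euler_scheme.intro euler_scheme_axioms.intro)
    show "random_mesh P N T M" by (rule random_mesh_axioms)
    show "complete_measure P" using F by blast
    show "W t \<in> borel_measurable P" if "0 \<le> t" for t
      using that W subalgebra[of "W t" t] by blast
    show "AE \<omega> in P. continuous_on {0..} (\<lambda>t. W t \<omega>)" using W by blast
    show "f differentiable at x" if "0 < x" for x
      unfolding f_def using that assms by (intro drift_differentiable)
    show "filterlim f at_top (at_right 0)"
      unfolding f_def using assms by (intro drift_at_zero)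
    show "\<forall>\<^sub>F x in at_top. f x \<le> (\<rho> - 1) * (a2 + \<rho> * a3\<^sup>2 / 2)"
      unfolding f_def using assms by (intro drift_at_infinity) auto
    have "h differentiable at x" for x
      using assms(17) by (simp add: condition_A_def C1_differentiable_on_eq)
    then have "continuous_on UNIV h"
      by (auto intro!: continuous_at_imp_continuous_on differentiable_imp_continuous_within)
    then show "h \<in> borel_measurable borel"
      by (rule borel_measurable_continuous_onI)
    show "0 < y + h y" if "0 < y" for y
    proof -
      obtain r where "0 < r" "r * y \<le> y + h y"
        using assms(17) \<open>0 < y\<close> unfolding condition_A_def by blast
      then show ?thesis
        using mult_pos_pos[of r y] that by linarith
    qed
  qed (use assms in auto)
  have ex: "\<exists>Zm Z. backward_euler_solution P W N T M f h a3 \<rho> x0 Zm Z \<and>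
      (\<forall>k. Zm k \<in> borel_measurable P \<and> Z k \<in> borel_measurable P)"
    using scheme_solution scheme_measurable scheme_left_measurable by blast
  have unique: "(\<forall>k\<le>mesh_last N T M \<omega>. Z k \<omega> = Z' k \<omega>) \<and>
      (\<forall>k\<in>{1..mesh_last N T M \<omega>}. Zm k \<omega> = Zm' k \<omega>)"
    if "backward_euler_solution P W N T M f h a3 \<rho> x0 Zm Z"
      "backward_euler_solution P W N T M f h a3 \<rho> x0 Zm' Z'" "\<omega> \<in> space P" for Zm Z Zm' Z' \<omega>
  proof (intro conjI allI impI ballI)
    fix k assume "k \<in> {1..mesh_last N T M \<omega>}"
    then obtain j where "k = Suc j" "j < mesh_last N T M \<omega>"
      by (cases k) auto
    then show "Zm k \<omega> = Zm' k \<omega>"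
      using solution_eq_scheme(2) that by metis
  qed (use solution_eq_scheme(1) that in metis)
  have pos: "\<P>(\<omega> in P. Z (k + 1) \<omega> > 0 \<bar> k < mesh_last N T M \<omega> \<and> Z k \<omega> > 0) = 1"
    if sol: "backward_euler_solution P W N T M f h a3 \<rho> x0 Zm Z" for Zm Z k
  proof -
    note [measurable] = scheme_measurable
    let ?R = "{\<omega> \<in> space P. k < mesh_last N T M \<omega> \<and> Z k \<omega> > 0}"
    let ?A = "{\<omega> \<in> space P. Z (k + 1) \<omega> > 0 \<and> k < mesh_last N T M \<omega> \<and> Z k \<omega> > 0}"
    have R: "?R = {\<omega> \<in> space P. k < mesh_last N T M \<omega> \<and> scheme k \<omega> > 0}"
      using solution_eq_scheme(1)[OF sol, of _ k] by auto
    have A: "?A = {\<omega> \<in> space P. scheme (k + 1) \<omega> > 0 \<and> k < mesh_last N T M \<omega> \<and> scheme k \<omega> > 0}"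
      using solution_eq_scheme(1)[OF sol, of _ k] solution_eq_scheme(1)[OF sol, of _ "k + 1"] by auto
    have meas: "?R \<in> events" "?A \<in> events"
      unfolding R A by measurable
    \<comment> \<open>Up to null sets, the condition and the conditioned event are both \<open>k < mesh_last\<close>.\<close>
    have "AE \<omega> in P. k < mesh_last N T M \<omega> \<longrightarrow> 0 < scheme k \<omega> \<and> 0 < scheme (k + 1) \<omega>"
      using AE_unit_jumps AE_space
    proof eventually_elim
      case (elim \<omega>)
      then show ?case
        using scheme_pos[OF elim(2,1), of k] scheme_pos[OF elim(2,1), of "k + 1"] by simp
    qed
    then have "AE \<omega> in P. (\<omega> \<in> ?A \<longleftrightarrow> \<omega> \<in> {\<omega> \<in> space P. k < mesh_last N T M \<omega>}) \<and>
        (\<omega> \<in> ?R \<longleftrightarrow> \<omega> \<in> {\<omega> \<in> space P. k < mesh_last N T M \<omega>})"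
      unfolding R A by eventually_elim auto
    then have "prob ?A = prob {\<omega> \<in> space P. k < mesh_last N T M \<omega>}"
      "prob ?R = prob {\<omega> \<in> space P. k < mesh_last N T M \<omega>}"
      using meas by (auto intro!: finite_measure_eq_AE)
    then show ?thesis
      using prob_less_mesh_last_pos[of k] by (simp add: cond_prob_def)
  qed
  show ?thesis
    using ex unique pos by blast
qed

end
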